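(* There is an algorithm and an absolute constant $C$ such that the following holds. Given as input a weighted undirected graph $G$ on $n$ vertices, a set $F$ of $f$ edges of $G$, a shortest path $\pi$ in $G \setminus F$, and a positive integer parameter $k$, the algorithm returns a partition $\pi = \pi_0 \circ e_0 \circ \dots \circ \pi_{q-1} \circ e_{q-1} \circ \pi_q$, where each $\pi_i$ is a (possibly empty) subpath of $\pi$, each $e_i$ is a single edge of $\pi$, and $q \le Ck$, together with fault sets $F_0, \dots, F_q \subseteq F$ with $|F_i| \le f/k$ for every $i$, such that each $\pi_i$ is a shortest path in $G \setminus F_i$. The algorithm runs in time polynomial in $n$ and $f$.
   Context: A weighted graph is a finite undirected graph with nonnegative edge weights; path lengths are sums of edge weights and shortest paths are with respect to these lengths. The notation $\pi_0 \circ e_0 \circ \pi_1 \circ \dots$ denotes concatenation of consecutive pieces of $\pi$ in order (an empty subpath consists of a single vertex). *)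

theory Defs
  imports Complex_Main
begin

section \<open>Weighted undirected graphs and shortest paths\<close>

text \<open>
  As usual for algorithmic inputs, the vertices of a graph on \<open>n\<close> vertices are \<open>0, \<dots>, n - 1\<close>.
  An undirected edge is a two-element set. Weights of non-edges are irrelevant.
\<close>

record wgraph =
  nverts :: nat
  edges :: "nat set set"
  weight :: "nat set \<Rightarrow> real"

definition weighted_graph :: "wgraph \<Rightarrow> bool" where
  "weighted_graph G \<longleftrightarrow>
     (\<forall>e\<in>edges G. \<exists>u v. u < nverts G \<and> v < nverts G \<and> u \<noteq> v \<and> e = {u, v}) \<and>
     (\<forall>e\<in>edges G. 0 \<le> weight G e)"

definition del_edges :: "wgraph \<Rightarrow> nat set set \<Rightarrow> wgraph" where
  "del_edges G F = G\<lparr>edges := edges G - F\<rparr>"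

text \<open>A path is given by its nonempty sequence of distinct vertices; a single vertex is an empty path.\<close>

definition is_path :: "wgraph \<Rightarrow> nat list \<Rightarrow> bool" where
  "is_path G p \<longleftrightarrow>
     p \<noteq> [] \<and> distinct p \<and> set p \<subseteq> {..<nverts G} \<and>
     (\<forall>i. Suc i < length p \<longrightarrow> {p ! i, p ! Suc i} \<in> edges G)"

definition path_length :: "wgraph \<Rightarrow> nat list \<Rightarrow> real" where
  "path_length G p = (\<Sum>i<length p - 1. weight G {p ! i, p ! Suc i})"

definition shortest_path :: "wgraph \<Rightarrow> nat list \<Rightarrow> bool" where
  "shortest_path G p \<longleftrightarrow>
     is_path G p \<and>
     (\<forall>p'. is_path G p' \<and> hd p' = hd p \<and> last p' = last p \<longrightarrow> path_length G p \<le> path_length G p')"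

text \<open>
  The decomposition of \<open>p\<close> into \<open>p\<^sub>0 \<circ> e\<^sub>0 \<circ> p\<^sub>1 \<circ> \<dots> \<circ> e\<^bsub>q-1\<^esub> \<circ> p\<^sub>q\<close>. The single edge \<open>e\<^sub>i\<close> leads from
  the last vertex of \<open>p\<^sub>i\<close> to the first vertex of \<open>p\<^bsub>i+1\<^esub>\<close>, so on the level of vertex sequences \<open>p\<close>
  is obtained by appending the nonempty sequences \<open>p\<^sub>0, \<dots>, p\<^sub>q\<close>.
\<close>

definition decomposition :: "nat list \<Rightarrow> nat list list \<Rightarrow> nat set list \<Rightarrow> bool" where
  "decomposition p ps es \<longleftrightarrow>
     length ps = Suc (length es) \<and>
     (\<forall>r\<in>set ps. r \<noteq> []) \<and>
     p = concat ps \<and>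
     (\<forall>i<length es. es ! i = {last (ps ! i), hd (ps ! Suc i)})"


section \<open>Algorithms and running time\<close>

text \<open>
  Algorithms are programs of a deterministic random access machine with two kinds of memory: cells
  holding natural numbers and cells holding edge weights (real numbers). A cell is addressed by
  the name of an array and a list of indices; a scalar variable is an array without indices.

  Each assignment and each test takes one unit of time; the expressions in them are part of the
  program text and hence contain a bounded number of operations. The operations on numbers are
  addition, truncated subtraction and comparison only: a unit-cost multiplication could build
  numbers with exponentially many bits in polynomial time. Weights can only be added, subtracted
  and compared, and they cannot be used as numbers or addresses. The only real constant is 0.
\<close>

type_synonym name = string

record state =
  nmem :: "name \<Rightarrow> nat list \<Rightarrow> nat"
  wmem :: "name \<Rightarrow> nat list \<Rightarrow> real"

datatype nexp = Num nat | NCell name "nexp list" | NAdd nexp nexp | NSub nexp nexp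

datatype wexp = WZero | WCell name "nexp list" | WAdd wexp wexp | WSub wexp wexp

datatype bexp = NLess nexp nexp | WLess wexp wexp | BNot bexp | BAnd bexp bexp

datatype prog =
    Skip
  | NAssign name "nexp list" nexp
  | WAssign name "nexp list" wexp
  | Seq prog prog
  | Cond bexp prog prog
  | Loop bexp prog

fun nval :: "nexp \<Rightarrow> state \<Rightarrow> nat" where
  "nval (Num c) s = c"
| "nval (NCell x is) s = nmem s x (map (\<lambda>a. nval a s) is)"
| "nval (NAdd a b) s = nval a s + nval b s"
| "nval (NSub a b) s = nval a s - nval b s"

fun wval :: "wexp \<Rightarrow> state \<Rightarrow> real" where
  "wval WZero s = 0"
| "wval (WCell x is) s = wmem s x (map (\<lambda>a. nval a s) is)"
| "wval (WAdd a b) s = wval a s + wval b s"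
| "wval (WSub a b) s = wval a s - wval b s"

fun bval :: "bexp \<Rightarrow> state \<Rightarrow> bool" where
  "bval (NLess a b) s \<longleftrightarrow> nval a s < nval b s"
| "bval (WLess a b) s \<longleftrightarrow> wval a s < wval b s"
| "bval (BNot b) s \<longleftrightarrow> \<not> bval b s"
| "bval (BAnd b c) s \<longleftrightarrow> bval b s \<and> bval c s"

definition update :: "(name \<Rightarrow> nat list \<Rightarrow> 'a) \<Rightarrow> name \<Rightarrow> nat list \<Rightarrow> 'a \<Rightarrow> (name \<Rightarrow> nat list \<Rightarrow> 'a)" where
  "update m x is a = m(x := (m x)(is := a))"

text \<open>\<open>exec P s t s'\<close>: started in state \<open>s\<close>, program \<open>P\<close> halts after time \<open>t\<close> in state \<open>s'\<close>.\<close>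

inductive exec :: "prog \<Rightarrow> state \<Rightarrow> nat \<Rightarrow> state \<Rightarrow> bool" where
  exec_Skip: "exec Skip s 1 s"
| exec_NAssign:
    "exec (NAssign x is a) s 1 (s\<lparr>nmem := update (nmem s) x (map (\<lambda>i. nval i s) is) (nval a s)\<rparr>)"
| exec_WAssign:
    "exec (WAssign x is a) s 1 (s\<lparr>wmem := update (wmem s) x (map (\<lambda>i. nval i s) is) (wval a s)\<rparr>)"
| exec_Seq: "exec P s t s' \<Longrightarrow> exec Q s' u s'' \<Longrightarrow> exec (Seq P Q) s (t + u) s''"
| exec_CondTrue: "bval b s \<Longrightarrow> exec P s t s' \<Longrightarrow> exec (Cond b P Q) s (1 + t) s'"
| exec_CondFalse: "\<not> bval b s \<Longrightarrow> exec Q s t s' \<Longrightarrow> exec (Cond b P Q) s (1 + t) s'"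
| exec_LoopFalse: "\<not> bval b s \<Longrightarrow> exec (Loop b P) s 1 s"
| exec_LoopTrue:
    "bval b s \<Longrightarrow> exec P s t s' \<Longrightarrow> exec (Loop b P) s' u s'' \<Longrightarrow> exec (Loop b P) s (1 + t + u) s''"

inductive_cases exec_elims:
  "exec Skip s t s'"
  "exec (NAssign x is a) s t s'"
  "exec (WAssign x is a) s t s'"
  "exec (Seq P Q) s t s'"
  "exec (Cond b P Q) s t s'"
  "exec (Loop b P) s t s'"

lemma exec_deterministic:
  "exec P s t s' \<Longrightarrow> exec P s u s'' \<Longrightarrow> u = t \<and> s'' = s'"
proof (induction arbitrary: u s'' rule: exec.induct)
  case (exec_Skip s)
  then show ?case by (simp add: exec.simps[of Skip])
next
  case (exec_NAssign x "is" a s)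
  then show ?case by (simp add: exec.simps[of "NAssign _ _ _"])
next
  case (exec_WAssign x "is" a s)
  then show ?case by (simp add: exec.simps[of "WAssign _ _ _"])
next
  case (exec_Seq P s t s1 Q t' s2)
  from exec_Seq.prems obtain v v' r where "u = v + v'" "exec P s v r" "exec Q r v' s''"
    by (rule exec_elims(4))
  then show ?case using exec_Seq.IH by metis
next
  case (exec_CondTrue b s P t s1 Q)
  from exec_CondTrue.prems obtain v where "u = 1 + v" "exec P s v s''"
    by (rule exec_elims(5)) (use exec_CondTrue.hyps(1) in simp_all)
  then show ?case using exec_CondTrue.IH by metis
next
  case (exec_CondFalse b s Q t s1 P)
  from exec_CondFalse.prems obtain v where "u = 1 + v" "exec Q s v s''"
    by (rule exec_elims(5)) (use exec_CondFalse.hyps(1) in simp_all)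
  then show ?case using exec_CondFalse.IH by metis
next
  case (exec_LoopFalse b s P)
  from exec_LoopFalse.prems show ?case
    by (rule exec_elims(6)) (use exec_LoopFalse.hyps(1) in simp_all)
next
  case (exec_LoopTrue b s P t s1 t' s2)
  from exec_LoopTrue.prems
  obtain v v' r where "u = 1 + v + v'" "exec P s v r" "exec (Loop b P) r v' s''"
    by (rule exec_elims(6)) (use exec_LoopTrue.hyps(1) in simp_all)
  then show ?case using exec_LoopTrue.IH by metis
qed


section \<open>Input and output conventions\<close>

text \<open>
  The graph and the fault set are given by adjacency matrices, the path by its vertex sequence. All
  cells that do not carry input are 0.
\<close>

definition input_state :: "wgraph \<Rightarrow> nat set set \<Rightarrow> nat list \<Rightarrow> nat \<Rightarrow> state" where
  "input_state G F p k = \<lparr>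
     nmem = (\<lambda>x is.
       if x = ''n'' \<and> is = [] then nverts G
       else if x = ''k'' \<and> is = [] then k
       else if x = ''len'' \<and> is = [] then length p
       else if x = ''path'' \<and> (\<exists>i<length p. is = [i]) then p ! hd is
       else if x = ''edge'' \<and> (\<exists>u v. is = [u, v] \<and> {u, v} \<in> edges G) then 1
       else if x = ''fault'' \<and> (\<exists>u v. is = [u, v] \<and> {u, v} \<in> F) then 1
       else 0),
     wmem = (\<lambda>x is.
       if x = ''weight'' \<and> (\<exists>u v. is = [u, v] \<and> {u, v} \<in> edges G)
       then weight G (set is) else 0)\<rparr>"

text \<open>
  On termination \<open>out_q\<close> holds \<open>q\<close>; the \<open>i\<close>-th subpath is the vertex sequence of length
  \<open>out_len[i]\<close> in row \<open>i\<close> of \<open>out_path\<close>; the endpoints of the \<open>i\<close>-th edge are \<open>out_edge[i,0]\<close> and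
  \<open>out_edge[i,1]\<close>; and \<open>{u, v}\<close> is in the \<open>i\<close>-th fault set iff \<open>out_fault[i,u,v]\<close> or
  \<open>out_fault[i,v,u]\<close> is 1.
\<close>

definition output_paths :: "state \<Rightarrow> nat list list" where
  "output_paths s =
     map (\<lambda>i. map (\<lambda>j. nmem s ''out_path'' [i, j]) [0..<nmem s ''out_len'' [i]])
       [0..<Suc (nmem s ''out_q'' [])]"

definition output_edges :: "state \<Rightarrow> nat set list" where
  "output_edges s =
     map (\<lambda>i. {nmem s ''out_edge'' [i, 0], nmem s ''out_edge'' [i, 1]}) [0..<nmem s ''out_q'' []]"

definition output_faults :: "state \<Rightarrow> nat set set list" where
  "output_faults s =
     map (\<lambda>i. {{u, v} | u v. nmem s ''out_fault'' [i, u, v] = 1}) [0..<Suc (nmem s ''out_q'' [])]"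

definition correct_output ::
  "real \<Rightarrow> wgraph \<Rightarrow> nat set set \<Rightarrow> nat list \<Rightarrow> nat \<Rightarrow>
   nat list list \<Rightarrow> nat set list \<Rightarrow> nat set set list \<Rightarrow> bool" where
  "correct_output C G F p k ps es Fs \<longleftrightarrow>
     decomposition p ps es \<and>
     real (length es) \<le> C * real k \<and>
     length Fs = length ps \<and>
     (\<forall>i<length ps.
        Fs ! i \<subseteq> F \<and>
        real (card (Fs ! i)) \<le> real (card F) / real k \<and>
        shortest_path (del_edges G (Fs ! i)) (ps ! i))"

end

theory Submission
  imports Defs
begin

text \<open>
  Let \<open>H = G - F\<close>, and let the ball of radius \<open>L\<close> around \<open>z\<close> be the set of directed faults \<open>(u, v)\<close>
  such that \<open>H\<close> has a walk from \<open>z\<close> to \<open>u\<close> of length less than \<open>L\<close>. If a path between the ends of a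
  piece of length \<open>L\<close> of \<open>p\<close> is shorter than the piece, then its first fault lies in the ball of radius \<open>L\<close>
  around the left end, and its last fault, reversed, in the ball around the right end. Hence removing
  either ball keeps the piece shortest, and one extends a piece greedily as long as one of its two
  balls contains at most a \<open>1 / (2k)\<close> fraction of the directed faults.

  Let \<open>X t\<close> be the position of the \<open>t\<close>-th cut and \<open>l t = X (t + 1) - X t\<close>. If a directed fault lies in the
  left balls of \<open>t\<close> and \<open>t'\<close> with \<open>t + 2 \<le> t'\<close>, then \<open>X t' - X t < l t + l t'\<close> because \<open>p\<close> is shortest in \<open>H\<close>,
  and thus \<open>l (t' - 1) < l t'\<close>. So a directed fault lies in the left balls of at most two pieces \<open>t\<close>
  with \<open>l t \<le> l (t - 1)\<close>, and symmetrically in the right balls of at most two pieces with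
  \<open>l t \<le> l (t + 1)\<close>. As the balls are large, each of the two classes has at most \<open>4k\<close> members, and of any two
  consecutive pieces one belongs to a class.
\<close>

section \<open>Walks of given length and their reduction to simple paths\<close>

section \<open>Walks\<close>

text \<open>Walks compose without a distinctness condition, which paths do not. The edge count
  \<open>r\<close> will be matched with the rounds of Bellman-Ford; the vertex sequence is
  forgotten.\<close>

inductive walk :: "wgraph \<Rightarrow> nat \<Rightarrow> nat \<Rightarrow> nat \<Rightarrow> real \<Rightarrow> bool" for G where
  walk_refl: "u < nverts G \<Longrightarrow> walk G 0 u u 0"
| walk_step: "walk G r u v l \<Longrightarrow> {v, z} \<in> edges G \<Longrightarrow> walk G (Suc r) u z (l + weight G {v, z})"

lemma weighted_graph_edgeD:
  assumes "weighted_graph G" "{u, v} \<in> edges G"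
  shows "u < nverts G" "v < nverts G" "0 \<le> weight G {u, v}"
  using assms unfolding weighted_graph_def by (metis doubleton_eq_iff)+

lemma walk_verts:
  assumes "weighted_graph G" "walk G r u v l"
  shows "u < nverts G" "v < nverts G"
  using assms(2) by (induction) (use weighted_graph_edgeD[OF assms(1)] in auto)

lemma walk_0: "walk G 0 u v l \<Longrightarrow> v = u \<and> l = 0"
  by (erule walk.cases) auto

lemma walk_nonneg:
  assumes "weighted_graph G" "walk G r u v l"
  shows "0 \<le> l"
  using assms(2) by induction (auto dest: weighted_graph_edgeD(3)[OF assms(1)])

lemma walk_trans:
  assumes "walk G r u v l" "walk G r' v w l'"
  shows "walk G (r + r') u w (l + l')"
  using assms(2,1)
proof (induction)
  case (walk_step r' v w l' z)
  from walk.walk_step[OF walk_step.IH[OF walk_step.prems] walk_step.hyps(2)]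
  show ?case by (simp add: algebra_simps)
qed simp

lemma walk_sym:
  assumes "weighted_graph G" "walk G r u v l"
  shows "walk G r v u l"
  using assms(2)
proof (induction)
  case (walk_step r u v l z)
  have "{z, v} \<in> edges G" using walk_step by (simp add: insert_commute)
  moreover have "walk G 0 z z 0"
    by (rule walk_refl) (use weighted_graph_edgeD[OF assms(1)] walk_step in blast)
  ultimately have "walk G 1 z v (weight G {v, z})"
    using walk.walk_step[of G 0 z z 0 v] by (simp add: insert_commute)
  from walk_trans[OF this walk_step.IH] show ?case by (simp add: algebra_simps)
qed (rule walk_refl)

lemma walk_sequence:
  assumes "h 0 < nverts G" "\<And>i. i < N \<Longrightarrow> {h i, h (Suc i)} \<in> edges G"
  shows "walk G N (h 0) (h N) (\<Sum>i<N. weight G {h i, h (Suc i)})"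
  using assms(2)
proof (induction N)
  case 0
  then show ?case using assms(1) by (simp add: walk_refl)
next
  case (Suc N)
  then show ?case using walk_step[of G N "h 0" "h N"] by simp
qed

lemma path_length_take_le:
  assumes "weighted_graph G" "is_path G p"
  shows "path_length G (take m p) \<le> path_length G p"
proof -
  have "path_length G (take m p) = (\<Sum>i<min (length p) m - 1. weight G {p ! i, p ! Suc i})"
    unfolding path_length_def by (intro sum.cong) auto
  also have "\<dots> \<le> path_length G p"
    unfolding path_length_def
    by (intro sum_mono2) (use assms weighted_graph_edgeD(3)[OF assms(1)] in \<open>auto simp: is_path_def\<close>)
  finally show ?thesis .
qed

text \<open>Loop erasure: if the new vertex already lies on the path built so far, the path is cut
  there, which cannot lengthen it because weights are nonnegative; otherwise the vertex is
  appended.\<close>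

lemma walk_imp_path:
  assumes wg: "weighted_graph G" and "walk G r u v l"
  shows "\<exists>p. is_path G p \<and> hd p = u \<and> last p = v \<and> path_length G p \<le> l"
  using assms(2)
proof (induction)
  case (walk_refl u)
  then show ?case by (intro exI[of _ "[u]"]) (auto simp: is_path_def path_length_def)
next
  case (walk_step r u v l z)
  then obtain p where p: "is_path G p" "hd p = u" "last p = v" "path_length G p \<le> l" by blast
  have ne: "p \<noteq> []" using p by (simp add: is_path_def)
  have w: "0 \<le> weight G {v, z}" "z < nverts G"
    using weighted_graph_edgeD[OF wg walk_step.hyps(2)] by auto
  show ?case
  proof (cases "z \<in> set p")
    case True
    then obtain i where i: "i < length p" "p ! i = z" by (auto simp: in_set_conv_nth)
    have "is_path G (take (Suc i) p)"
      using p(1) i set_take_subset[of "Suc i" p] unfolding is_path_def by auto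
    moreover have "hd (take (Suc i) p) = u" using p(2) ne by (cases p) auto
    moreover have "last (take (Suc i) p) = z" using i by (simp add: take_Suc_conv_app_nth)
    moreover have "path_length G (take (Suc i) p) \<le> l + weight G {v, z}"
      using path_length_take_le[OF wg p(1), of "Suc i"] p(4) w by linarith
    ultimately show ?thesis by blast
  next
    case False
    have e: "{(p @ [z]) ! i, (p @ [z]) ! Suc i} \<in> edges G" if "Suc i < length (p @ [z])" for i
    proof (cases "Suc i < length p")
      case True
      then show ?thesis using p(1) by (auto simp: is_path_def nth_append)
    next
      case False
      then have "i = length p - 1" "Suc i = length p" using that by auto
      then show ?thesis using p(3) ne walk_step.hyps(2) by (simp add: nth_append last_conv_nth)
    qed
    have "is_path G (p @ [z])"
      using p(1) w(2) False e unfolding is_path_def by auto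
    moreover have "path_length G (p @ [z]) = path_length G p + weight G {v, z}"
    proof -
      obtain m where m: "length p = Suc m" using ne by (cases "length p") auto
      have "(\<Sum>i<m. weight G {(p @ [z]) ! i, (p @ [z]) ! Suc i}) = (\<Sum>i<m. weight G {p ! i, p ! Suc i})"
        by (intro sum.cong) (auto simp: nth_append m)
      moreover have "p ! m = v" using p(3) ne m by (simp add: last_conv_nth)
      ultimately show ?thesis unfolding path_length_def by (simp add: m nth_append)
    qed
    ultimately show ?thesis using p ne by (intro exI[of _ "p @ [z]"]) auto
  qed
qed

lemma is_path_length_le:
  assumes "is_path G p"
  shows "length p \<le> nverts G"
  using assms card_mono[of "{..<nverts G}" "set p"] unfolding is_path_def
  by (simp add: distinct_card)

lemma path_walk:
  assumes "is_path G p"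
  shows "walk G (length p - 1) (hd p) (last p) (path_length G p)"
proof -
  have ne: "p \<noteq> []" using assms by (simp add: is_path_def)
  then have "p ! 0 \<in> set p" by simp
  then have "p ! 0 < nverts G" using assms unfolding is_path_def by blast
  with ne show ?thesis
    using walk_sequence[of "(!) p" G "length p - 1"] assms
    by (simp add: is_path_def path_length_def hd_conv_nth last_conv_nth)
qed

text \<open>Distances are attained by simple paths, hence by walks with at most
  \<open>nverts G\<close> edges. This is why \<open>nverts G\<close> rounds of Bellman-Ford
  suffice.\<close>

lemma short_walk:
  assumes "weighted_graph G" "walk G r u v l"
  obtains r' l' where "r' \<le> nverts G" "l' \<le> l" "walk G r' u v l'"
proof -
  obtain p where p: "is_path G p" "hd p = u" "last p = v" "path_length G p \<le> l"
    using walk_imp_path[OF assms] by blast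
  show thesis
    by (rule that[OF _ p(4)]) (use path_walk[OF p(1)] p is_path_length_le[OF p(1)] in auto)
qed

section \<open>Double counting of pieces with large balls\<close>

section \<open>Counting pieces\<close>

text \<open>An element lies in \<open>S t\<close> only for the least such index and possibly its
  successor, because every later set is disjoint from the first one.\<close>

lemma sum_card_le_double:
  fixes S :: "nat \<Rightarrow> 'a set"
  assumes T: "finite T" and D: "finite D" "\<And>t. t \<in> T \<Longrightarrow> S t \<subseteq> D"
    and dis: "\<And>t t'. t \<in> T \<Longrightarrow> t' \<in> T \<Longrightarrow> t + 2 \<le> t' \<Longrightarrow> S t \<inter> S t' = {}"
  shows "(\<Sum>t\<in>T. card (S t)) \<le> 2 * card D"
proof -
  have fin: "finite (S t)" if "t \<in> T" for t using D that finite_subset by blast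
  have le: "card {t \<in> T. d \<in> S t} \<le> 2" for d
  proof (cases "{t \<in> T. d \<in> S t} = {}")
    case False
    let ?M = "{t \<in> T. d \<in> S t}"
    let ?m = "Min ?M"
    have m: "?m \<in> ?M" using False T by (intro Min_in) auto
    have "?M \<subseteq> {?m, Suc ?m}"
    proof
      fix t assume t: "t \<in> ?M"
      then have "?m \<le> t" using T by simp
      moreover have "\<not> ?m + 2 \<le> t" using dis[of ?m t] m t by blast
      ultimately show "t \<in> {?m, Suc ?m}" by auto
    qed
    then show ?thesis using card_mono[of "{?m, Suc ?m}" ?M] by simp
  qed (metis card.empty zero_le)
  have "(\<Sum>t\<in>T. card (S t)) = (\<Sum>t\<in>T. \<Sum>d\<in>D. if d \<in> S t then 1 else 0)"
  proof (intro sum.cong refl)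
    fix t assume "t \<in> T"
    then have "S t = {d \<in> D. d \<in> S t}" using D by blast
    then show "card (S t) = (\<Sum>d\<in>D. if d \<in> S t then 1 else 0)"
      using D(1) by (simp add: sum.If_cases Int_def)
  qed
  also have "\<dots> = (\<Sum>d\<in>D. \<Sum>t\<in>T. if d \<in> S t then 1 else 0)" by (rule sum.swap)
  also have "\<dots> = (\<Sum>d\<in>D. card {t \<in> T. d \<in> S t})"
    using T by (simp add: sum.If_cases Int_def)
  also have "\<dots> \<le> (\<Sum>d\<in>D. 2)" by (intro sum_mono le)
  finally show ?thesis by simp
qed

text \<open>\<open>X\<close> stands for the positions of the cuts along the path, \<open>S\<close>
  and \<open>S'\<close> for the left and right balls. Stripped of graphs, the count uses monotone
  cuts, large balls and two strict overlap inequalities.\<close>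

lemma segment_count:
  fixes X :: "nat \<Rightarrow> real" and S S' :: "nat \<Rightarrow> 'a set"
  assumes X: "\<And>i j. i \<le> j \<Longrightarrow> j \<le> q \<Longrightarrow> X i \<le> X j"
    and D: "finite D" "\<And>t. t < q \<Longrightarrow> S t \<subseteq> D" "\<And>t. t < q \<Longrightarrow> S' t \<subseteq> D"
    and large: "\<And>t. t < q \<Longrightarrow> card D < 2 * k * card (S t)" "\<And>t. t < q \<Longrightarrow> card D < 2 * k * card (S' t)"
    and S: "\<And>t t' d. t < t' \<Longrightarrow> t' < q \<Longrightarrow> d \<in> S t \<Longrightarrow> d \<in> S t' \<Longrightarrow>
        X t' - X t < (X (Suc t) - X t) + (X (Suc t') - X t')"
    and S': "\<And>t t' d. t < t' \<Longrightarrow> t' < q \<Longrightarrow> d \<in> S' t \<Longrightarrow> d \<in> S' t' \<Longrightarrow>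
        X (Suc t') - X (Suc t) < (X (Suc t) - X t) + (X (Suc t') - X t')"
  shows "q \<le> 8 * k + 1"
proof -
  \<comment> \<open>Largeness is strict, so each member of \<open>T\<close> contributes at least
    \<open>card D + 1\<close>; more than \<open>4 * k\<close> members would exceed
    \<open>2 * k\<close> times the double-counting bound \<open>2 * card D\<close>.\<close>
  have bound: "card T \<le> 4 * k"
    if T: "finite T" "T \<subseteq> {..<q}" and R: "\<And>t. t < q \<Longrightarrow> R t \<subseteq> D" "\<And>t. t < q \<Longrightarrow> card D < 2 * k * card (R t)"
      and dis: "\<And>t t'. t \<in> T \<Longrightarrow> t' \<in> T \<Longrightarrow> t + 2 \<le> t' \<Longrightarrow> R t \<inter> R t' = {}" for T and R :: "nat \<Rightarrow> 'a set"
  proof (rule ccontr)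
    assume "\<not> card T \<le> 4 * k"
    then have "(4 * k + 1) * (card D + 1) \<le> card T * (card D + 1)" by (intro mult_right_mono) auto
    also have "\<dots> = (\<Sum>t\<in>T. card D + 1)" by simp
    also have "\<dots> \<le> (\<Sum>t\<in>T. 2 * k * card (R t))"
      by (intro sum_mono) (use T R(2) in \<open>simp add: Suc_le_eq subset_iff\<close>)
    also have "\<dots> = 2 * k * (\<Sum>t\<in>T. card (R t))" by (simp add: sum_distrib_left)
    also have "\<dots> \<le> 2 * k * (2 * card D)"
      by (intro mult_left_mono sum_card_le_double) (use T R D dis in auto)
    finally show False by (simp add: algebra_simps)
  qed
  \<comment> \<open>\<open>T\<close> collects the pieces no longer than their predecessor,
    \<open>T'\<close> those no longer than their successor; the index conditions ensure that this
    neighbour exists.\<close>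
  define T where "T = {t. 0 < t \<and> t < q \<and> X (Suc t) - X t \<le> X t - X (t - 1)}"
  define T' where "T' = {t. Suc t < q \<and> X (Suc t) - X t \<le> X (Suc (Suc t)) - X (Suc t)}"
  have TT': "T \<subseteq> {..<q}" "T' \<subseteq> {..<q}" by (auto simp: T_def T'_def)
  then have fin: "finite T" "finite T'" by (auto intro: finite_subset)
  have "card T \<le> 4 * k"
  proof (rule bound[OF fin(1) TT'(1) D(2) large(1)])
    show "S t \<inter> S t' = {}" if t: "t \<in> T" "t' \<in> T" "t + 2 \<le> t'" for t t'
    proof (rule ccontr)
      assume "S t \<inter> S t' \<noteq> {}"
      then obtain d where "d \<in> S t" "d \<in> S t'" by blast
      then have "X t' - X t < (X (Suc t) - X t) + (X (Suc t') - X t')"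
        using t by (intro S) (auto simp: T_def)
      \<comment> \<open>The gap between \<open>t\<close> and \<open>t'\<close> leaves room for the
        whole piece \<open>t' - 1\<close>, so the overlap inequality makes it shorter than piece
        \<open>t'\<close>, contrary to the choice of \<open>T\<close>.\<close>
      moreover have "X (Suc t) \<le> X (t' - 1)" using t by (intro X) (auto simp: T_def)
      ultimately show False using t by (auto simp: T_def)
    qed
  qed
  moreover have "card T' \<le> 4 * k"
  proof (rule bound[OF fin(2) TT'(2) D(3) large(2)])
    show "S' t \<inter> S' t' = {}" if t: "t \<in> T'" "t' \<in> T'" "t + 2 \<le> t'" for t t'
    proof (rule ccontr)
      assume "S' t \<inter> S' t' \<noteq> {}"
      then obtain d where "d \<in> S' t" "d \<in> S' t'" by blast
      then have "X (Suc t') - X (Suc t) < (X (Suc t) - X t) + (X (Suc t') - X t')"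
        using t by (intro S') (auto simp: T'_def)
      \<comment> \<open>Mirror image: piece \<open>t + 1\<close> fits in between and would be
        shorter than piece \<open>t\<close>.\<close>
      moreover have "X (Suc (Suc t)) \<le> X t'" using t by (intro X) (auto simp: T'_def)
      ultimately show False using t by (auto simp: T'_def)
    qed
  qed
  moreover have "q - 1 \<le> card T + card T'"
  proof -
    \<comment> \<open>Of two neighbours, one is not longer than the other: \<open>t + 1\<close> lies
      in \<open>T\<close> or \<open>t\<close> lies in \<open>T'\<close>.\<close>
    have "Suc ` {..<q - 1} \<subseteq> T \<union> Suc ` T'"
      by (auto simp: T_def T'_def image_iff)
    then have "card (Suc ` {..<q - 1}) \<le> card (T \<union> Suc ` T')"
      using fin by (intro card_mono) auto
    also have "\<dots> \<le> card T + card (Suc ` T')" by (rule card_Un_le)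
    finally show ?thesis by (simp add: card_image)
  qed
  ultimately show ?thesis by linarith
qed

lemma sum_pos_diff:
  fixes w :: "nat \<Rightarrow> real"
  assumes "a \<le> b"
  shows "(\<Sum>i<b. w i) - (\<Sum>i<a. w i) = (\<Sum>i<b - a. w (a + i))"
proof -
  obtain m where "b = a + m" using assms le_Suc_ex by blast
  then show ?thesis by (induction m arbitrary: b) auto
qed

section \<open>Replacement paths and balls of directed faults\<close>

section \<open>Balls around the ends of a piece\<close>

lemma del_edges_simps [simp]:
  "nverts (del_edges G F) = nverts G"
  "edges (del_edges G F) = edges G - F"
  "weight (del_edges G F) = weight G"
  by (simp_all add: del_edges_def)

lemma path_length_del_edges [simp]: "path_length (del_edges G F) = path_length G"
  by (simp add: path_length_def fun_eq_iff)

locale replacement_path =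
  fixes G :: wgraph and F :: "nat set set" and p :: "nat list"
  assumes wg: "weighted_graph G" and faults: "F \<subseteq> edges G"
    and shortest: "shortest_path (del_edges G F) p"
begin

abbreviation H :: wgraph where
  "H \<equiv> del_edges G F"

text \<open>The distance from the start of \<open>p\<close>, measured along \<open>p\<close>;
  meaningful only for \<open>m < length p\<close>.\<close>

definition pos :: "nat \<Rightarrow> real" where
  "pos m = (\<Sum>i<m. weight G {p ! i, p ! Suc i})"

text \<open>Faults are counted once per direction, since membership in a ball depends on the end
  from which a fault is entered. This also fits the program's scan over ordered pairs.\<close>

definition arcs :: "(nat \<times> nat) set" where
  "arcs = {(u, v). {u, v} \<in> F}"

text \<open>Only the tail \<open>u\<close> has to be close. The strict \<open>l < L\<close> makes
  the ball of radius 0 empty and yields the strict inequalities of the counting argument.\<close>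

definition ball :: "nat \<Rightarrow> real \<Rightarrow> (nat \<times> nat) set" where
  "ball z L = {(u, v). {u, v} \<in> F \<and> (\<exists>r l. walk H r z u l \<and> l < L)}"

lemma wgH: "weighted_graph H"
  using wg by (simp add: weighted_graph_def)

lemma pathH: "is_path H p"
  using shortest by (simp add: shortest_path_def)

lemma p_nonempty: "p \<noteq> []"
  using pathH by (simp add: is_path_def)

lemma nth_p_less: "i < length p \<Longrightarrow> p ! i < nverts G"
  using pathH nth_mem[of i p] unfolding is_path_def del_edges_simps by blast

lemma length_p_le: "length p \<le> nverts G"
  using is_path_length_le[OF pathH] by simp

lemma p_edge: "Suc i < length p \<Longrightarrow> {p ! i, p ! Suc i} \<in> edges G - F"
  using pathH by (auto simp: is_path_def)

lemma fault_verts: "{u, v} \<in> F \<Longrightarrow> u < nverts G \<and> v < nverts G"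
  using weighted_graph_edgeD(1,2)[OF wg] faults by blast

lemma arcs_subset: "arcs \<subseteq> {..<nverts G} \<times> {..<nverts G}"
  using fault_verts by (auto simp: arcs_def)

lemma finite_arcs: "finite arcs"
  using arcs_subset by (rule finite_subset) simp

lemma ball_subset_arcs: "ball z L \<subseteq> arcs"
  by (auto simp: ball_def arcs_def)

lemma finite_F: "finite F"
proof (rule finite_subset)
  show "F \<subseteq> Pow {..<nverts G}"
    using faults wg by (fastforce simp: weighted_graph_def)
qed simp

text \<open>Orient each fault by some \<open>d\<close>; every arc is a chosen orientation or its
  reversal. The factor 2 turns a share of 1 / (2k) of the arcs into the required bound f /
  k.\<close>

lemma card_arcs_le: "card arcs \<le> 2 * card F"
proof -
  have "\<forall>e\<in>F. \<exists>d. e = {fst d, snd d}"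
    using wg faults unfolding weighted_graph_def by fastforce
  then obtain d where d: "\<And>e. e \<in> F \<Longrightarrow> e = {fst (d e), snd (d e)}" by metis
  have "arcs \<subseteq> d ` F \<union> prod.swap ` d ` F"
  proof
    fix x assume "x \<in> arcs"
    then have F: "{fst x, snd x} \<in> F" by (auto simp: arcs_def)
    have "x = d {fst x, snd x} \<or> x = prod.swap (d {fst x, snd x})"
      using d[OF F] by (auto simp: doubleton_eq_iff prod_eq_iff)
    then show "x \<in> d ` F \<union> prod.swap ` d ` F" using F by blast
  qed
  then have "card arcs \<le> card (d ` F \<union> prod.swap ` d ` F)"
    by (rule card_mono[rotated]) (simp add: finite_F)
  moreover have "card (d ` F \<union> prod.swap ` d ` F) \<le> card (d ` F) + card (prod.swap ` d ` F)"
    by (rule card_Un_le)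
  moreover have "card (d ` F) \<le> card F" "card (prod.swap ` d ` F) \<le> card (d ` F)"
    using finite_F by (simp_all add: card_image_le)
  ultimately show ?thesis by linarith
qed

lemma pos_diff:
  assumes "a \<le> b"
  shows "pos b - pos a = (\<Sum>i<b - a. weight G {p ! (a + i), p ! (a + Suc i)})"
  using sum_pos_diff[OF assms, of "\<lambda>i. weight G {p ! i, p ! Suc i}"] by (simp add: pos_def)

lemma pos_mono:
  assumes "a \<le> b" "b < length p"
  shows "pos a \<le> pos b"
proof -
  have "0 \<le> pos b - pos a"
    unfolding pos_diff[OF assms(1)]
    by (intro sum_nonneg weighted_graph_edgeD(3)[OF wgH, unfolded del_edges_simps])
      (use p_edge assms in auto)
  then show ?thesis by simp
qed

lemma walk_piece:
  assumes "a \<le> b" "b < length p"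
  shows "walk H (b - a) (p ! a) (p ! b) (pos b - pos a)"
  using walk_sequence[of "\<lambda>i. p ! (a + i)" H "b - a"] assms p_edge nth_p_less
  by (simp add: pos_diff)

text \<open>Subpaths of a shortest path are shortest, even among walks: insert the walk between a
  prefix and a suffix of \<open>p\<close> and reduce the result to a simple path.\<close>

lemma walk_ge:
  assumes ab: "a \<le> b" "b < length p" and w: "walk H r (p ! a) (p ! b) l"
  shows "pos b - pos a \<le> l"
proof -
  let ?m = "length p - 1"
  have m: "b \<le> ?m" "?m < length p" using ab p_nonempty by auto
  have "walk H (a - 0) (p ! 0) (p ! a) (pos a - pos 0)"
    by (rule walk_piece) (use ab in auto)
  from walk_trans[OF walk_trans[OF this w] walk_piece[OF m]]
  obtain p' where p': "is_path H p'" "hd p' = hd p" "last p' = last p"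
    "path_length G p' \<le> pos a - pos 0 + l + (pos ?m - pos b)"
    using walk_imp_path[OF wgH] p_nonempty by (fastforce simp: hd_conv_nth last_conv_nth)
  then have "path_length G p \<le> path_length G p'"
    using shortest by (simp add: shortest_path_def)
  then show ?thesis using p'(4) by (simp add: path_length_def pos_def)
qed

text \<open>As long as the sequence stays within distance less than \<open>L\<close> of its start, it cannot cross a fault
  outside the ball.\<close>

lemma short_sequence_avoids_faults:
  assumes h: "h 0 < nverts G" "\<And>i. i < N \<Longrightarrow> {h i, h (Suc i)} \<in> edges G - (\<lambda>(u, v). {u, v}) ` ball (h 0) L"
    and short: "(\<Sum>i<N. weight G {h i, h (Suc i)}) < L"
  shows "walk H N (h 0) (h N) (\<Sum>i<N. weight G {h i, h (Suc i)})"
proof -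
  have "walk H m (h 0) (h m) (\<Sum>i<m. weight G {h i, h (Suc i)})" if "m \<le> N" for m
    using that
  proof (induction m)
    case 0
    then show ?case using h(1) by (simp add: walk_refl)
  next
    case (Suc m)
    then have w: "walk H m (h 0) (h m) (\<Sum>i<m. weight G {h i, h (Suc i)})" by simp
    have "(\<Sum>i<m. weight G {h i, h (Suc i)}) \<le> (\<Sum>i<N. weight G {h i, h (Suc i)})"
      by (intro sum_mono2) (use h(2) weighted_graph_edgeD(3)[OF wg] Suc.prems in auto)
    then have "{h m, h (Suc m)} \<notin> F \<or> (h m, h (Suc m)) \<in> ball (h 0) L"
      using w short by (auto simp: ball_def intro: le_less_trans)
    moreover have "{h m, h (Suc m)} \<in> edges G" "(h m, h (Suc m)) \<notin> ball (h 0) L"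
      using h(2)[of m] Suc.prems by force+
    ultimately show ?case using walk_step[OF w, of "h (Suc m)"] by simp
  qed
  then show ?thesis by blast
qed

text \<open>A shorter rival avoiding \<open>S\<close> would lie in \<open>H\<close> by
  \<open>short_sequence_avoids_faults\<close>, against \<open>walk_ge\<close>. For the ball at the
  right end the rival is read backwards.\<close>

lemma shortest_piece:
  assumes ab: "a \<le> b" "b < length p" and z: "z = p ! a \<or> z = p ! b"
  defines "S \<equiv> (\<lambda>(u, v). {u, v}) ` ball z (pos b - pos a)"
  shows "shortest_path (del_edges G S) (map ((!) p) [a..<Suc b])"
proof -
  let ?s = "map ((!) p) [a..<Suc b]"
  have SF: "S \<subseteq> F" by (auto simp: S_def ball_def)
  have ends: "hd ?s = p ! a" "last ?s = p ! b"
    using ab by (simp_all add: hd_map last_map del: upt_Suc)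
  have len: "path_length G ?s = pos b - pos a"
    unfolding pos_diff[OF ab(1)] path_length_def using ab
    by (intro sum.cong) (auto simp del: upt_Suc)
  have path: "is_path (del_edges G S) ?s"
    unfolding is_path_def
  proof (intro conjI allI impI)
    show "distinct ?s" using pathH ab by (auto simp: is_path_def distinct_map inj_on_nth simp del: upt_Suc)
    show "set ?s \<subseteq> {..<nverts (del_edges G S)}" using nth_p_less ab by auto
    fix i assume i: "Suc i < length ?s"
    then have "Suc (a + i) < length p" using ab by (simp del: upt_Suc)
    with i show "{?s ! i, ?s ! Suc i} \<in> edges (del_edges G S)"
      using p_edge[of "a + i"] ab SF by (auto simp del: upt_Suc)
  qed (use ab in simp)
  have "pos b - pos a \<le> path_length G p'"
    if p': "is_path (del_edges G S) p'" "hd p' = p ! a" "last p' = p ! b" for p'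
  proof (rule ccontr)
    assume "\<not> ?thesis"
    then have less: "path_length G p' < pos b - pos a" by simp
    define N where "N = length p' - 1"
    have ne: "p' \<noteq> []" using p' by (simp add: is_path_def)
    have N: "p' ! 0 = p ! a" "p' ! N = p ! b" "length p' = Suc N"
      using p' ne by (auto simp: N_def hd_conv_nth last_conv_nth)
    have e: "{p' ! i, p' ! Suc i} \<in> edges G - S" if "i < N" for i
      using p'(1) that N(3) by (auto simp: is_path_def)
    have pl: "path_length G p' = (\<Sum>i<N. weight G {p' ! i, p' ! Suc i})"
      by (simp add: path_length_def N_def)
    show False
    proof (cases "z = p ! a")
      case True
      have "walk H N (p' ! 0) (p' ! N) (\<Sum>i<N. weight G {p' ! i, p' ! Suc i})"
        by (rule short_sequence_avoids_faults)
          (use e less ab nth_p_less in \<open>auto simp: N True pl S_def\<close>)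
      then show False using walk_ge[OF ab] N pl less by fastforce
    next
      case False
      with z have z: "z = p ! b" by simp
      define h where "h i = p' ! (N - i)" for i
      \<comment> \<open>Reversal turns edge \<open>i\<close> into edge \<open>N - Suc i\<close>, and
        reindexing the sum preserves the length.\<close>
      have "(\<Sum>i<N. weight G {h i, h (Suc i)}) = (\<Sum>i<N. weight G {p' ! (N - Suc i), p' ! Suc (N - Suc i)})"
        by (intro sum.cong) (auto simp: h_def insert_commute Suc_diff_Suc)
      also have "\<dots> = path_length G p'"
        unfolding pl by (rule sum.nat_diff_reindex)
      finally have hl: "(\<Sum>i<N. weight G {h i, h (Suc i)}) = path_length G p'" .
      have he: "{h i, h (Suc i)} \<in> edges G - S" if "i < N" for i
        using e[of "N - Suc i"] that by (simp add: h_def insert_commute Suc_diff_Suc)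
      have h0: "h 0 = p ! b" "h N = p ! a" by (simp_all add: h_def N)
      have "walk H N (h 0) (h N) (\<Sum>i<N. weight G {h i, h (Suc i)})"
        by (rule short_sequence_avoids_faults[where L = "pos b - pos a"])
          (use he less ab nth_p_less in \<open>auto simp: h0 z hl S_def\<close>)
      then have "walk H N (p ! a) (p ! b) (path_length G p')"
        unfolding h0 hl by (rule walk_sym[OF wgH])
      from walk_ge[OF ab this] less show False by simp
    qed
  qed
  then show ?thesis
    unfolding shortest_path_def ends del_edges_simps path_length_del_edges len using path by blast
qed

lemma number_of_pieces:
  assumes c: "\<And>i. i < q \<Longrightarrow> c i < c (Suc i)" "c q < length p"
    and large: "\<And>i. i < q \<Longrightarrow> card arcs < 2 * k * card (ball (p ! c i) (pos (c (Suc i)) - pos (c i)))"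
      "\<And>i. i < q \<Longrightarrow> card arcs < 2 * k * card (ball (p ! c (Suc i)) (pos (c (Suc i)) - pos (c i)))"
  shows "q \<le> 8 * k + 1"
proof -
  have mono: "c i \<le> c j" if "i \<le> j" "j \<le> q" for i j
    using that
  proof (induction j rule: dec_induct)
    case (step m)
    then show ?case using c(1)[of m] by simp
  qed simp
  \<comment> \<open>Joining the two walks at the common tail \<open>u\<close> gives a walk of length
    below \<open>L + L'\<close> between two vertices of \<open>p\<close>, and such a walk is at
    least as long as \<open>p\<close> between them.\<close>
  have near: "pos b - pos a < L + L'"
    if "a \<le> b" "b < length p" "d \<in> ball (p ! a) L" "d \<in> ball (p ! b) L'" for a b d L L'
  proof -
    obtain u v where "d = (u, v)" by (cases d)
    then obtain r l r' l' where "walk H r (p ! a) u l" "l < L" "walk H r' (p ! b) u l'" "l' < L'"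
      using \<open>d \<in> ball (p ! a) L\<close> \<open>d \<in> ball (p ! b) L'\<close> by (auto simp: ball_def)
    with walk_ge[OF \<open>a \<le> b\<close> \<open>b < length p\<close> walk_trans[OF _ walk_sym[OF wgH]]]
    show ?thesis by fastforce
  qed
  show ?thesis
  proof (rule segment_count[where X = "\<lambda>i. pos (c i)" and D = arcs and
      S = "\<lambda>i. ball (p ! c i) (pos (c (Suc i)) - pos (c i))" and
      S' = "\<lambda>i. ball (p ! c (Suc i)) (pos (c (Suc i)) - pos (c i))"])
    show "pos (c i) \<le> pos (c j)" if "i \<le> j" "j \<le> q" for i j
      using that c(2) mono[of i j] mono[of j q] by (intro pos_mono) auto
  next
    fix t t' d
    assume t: "t < t'" "t' < q"
    have le: "c t \<le> c t'" "c (Suc t) \<le> c (Suc t')" "c t' < length p" "c (Suc t') < length p"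
      using mono[of t t'] mono[of "Suc t" "Suc t'"] mono[of t' q] mono[of "Suc t'" q] t c(2) by auto
    show "pos (c t') - pos (c t) < (pos (c (Suc t)) - pos (c t)) + (pos (c (Suc t')) - pos (c t'))"
      if "d \<in> ball (p ! c t) (pos (c (Suc t)) - pos (c t))"
        "d \<in> ball (p ! c t') (pos (c (Suc t')) - pos (c t'))"
      using near[OF le(1,3) that] .
    show "pos (c (Suc t')) - pos (c (Suc t)) < (pos (c (Suc t)) - pos (c t)) + (pos (c (Suc t')) - pos (c t'))"
      if "d \<in> ball (p ! c (Suc t)) (pos (c (Suc t)) - pos (c t))"
        "d \<in> ball (p ! c (Suc t')) (pos (c (Suc t')) - pos (c t'))"
      using near[OF le(2,4) that] .
  qed (use large ball_subset_arcs finite_arcs in auto)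
qed

end

section \<open>A program logic with time budgets and frame conditions\<close>

section \<open>Total correctness with time bounds\<close>

fun writes :: "prog \<Rightarrow> name set" where
  "writes Skip = {}"
| "writes (NAssign x is a) = {x}"
| "writes (WAssign x is a) = {x}"
| "writes (Seq P Q) = writes P \<union> writes Q"
| "writes (Cond b P Q) = writes P \<union> writes Q"
| "writes (Loop b P) = writes P"

text \<open>Preservation is tracked per array name, for both memories at once; changes inside one
  array must be described by postconditions.\<close>

definition frame :: "name set \<Rightarrow> state \<Rightarrow> state \<Rightarrow> bool" where
  "frame X s s' \<longleftrightarrow> (\<forall>x. x \<notin> X \<longrightarrow> nmem s' x = nmem s x \<and> wmem s' x = wmem s x)"

lemma frameD:
  assumes "frame X s s'" "x \<notin> X"
  shows "nmem s' x = nmem s x" "wmem s' x = wmem s x"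
  using assms by (auto simp: frame_def)

lemma frame_trans: "frame X s s' \<Longrightarrow> frame X s' s'' \<Longrightarrow> frame X s s''"
  by (simp add: frame_def)

lemma frame_mono: "frame X s s' \<Longrightarrow> X \<subseteq> Y \<Longrightarrow> frame Y s s'"
  by (auto simp: frame_def)

lemma update_apply: "update m x is a y = (if y = x then (m x)(is := a) else m y)"
  by (simp add: update_def)

lemma exec_frame: "exec P s t s' \<Longrightarrow> frame (writes P) s s'"
proof (induction rule: exec.induct)
  case exec_Seq
  then show ?case by (auto intro: frame_trans frame_mono)
next
  case exec_LoopTrue
  then show ?case by (auto intro: frame_trans)
qed (auto simp: frame_def update_apply)

text \<open>Total correctness with a time budget. As execution is deterministic, one halting run
  describes all runs.\<close>

definition wp :: "prog \<Rightarrow> nat \<Rightarrow> (state \<Rightarrow> bool) \<Rightarrow> state \<Rightarrow> bool" where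
  "wp P T Q s \<longleftrightarrow> (\<exists>t s'. exec P s t s' \<and> t \<le> T \<and> Q s')"

text \<open>The frame of the program is supplied together with the postcondition, so specifications
  need not list the arrays that stay unchanged.\<close>

lemma wp_mono:
  assumes "wp P T Q s" "T \<le> T'" "\<And>s'. Q s' \<Longrightarrow> frame (writes P) s s' \<Longrightarrow> Q' s'"
  shows "wp P T' Q' s"
  using assms exec_frame unfolding wp_def by (meson order_trans)

lemma wp_Skip: "Q s \<Longrightarrow> wp Skip 1 Q s"
  unfolding wp_def using exec_Skip by blast

lemma wp_NAssign:
  "Q (s\<lparr>nmem := update (nmem s) x (map (\<lambda>i. nval i s) is) (nval a s)\<rparr>) \<Longrightarrow> wp (NAssign x is a) 1 Q s"
  unfolding wp_def using exec_NAssign by blast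

lemma wp_WAssign:
  "Q (s\<lparr>wmem := update (wmem s) x (map (\<lambda>i. nval i s) is) (wval a s)\<rparr>) \<Longrightarrow> wp (WAssign x is a) 1 Q s"
  unfolding wp_def using exec_WAssign by blast

lemma wp_Seq:
  assumes "wp P T R s" "\<And>s'. R s' \<Longrightarrow> frame (writes P) s s' \<Longrightarrow> wp P' T' Q s'"
  shows "wp (Seq P P') (T + T') Q s"
proof -
  from assms(1) obtain t s' where "exec P s t s'" "t \<le> T" "R s'" by (auto simp: wp_def)
  with assms(2)[OF \<open>R s'\<close> exec_frame] show ?thesis
    unfolding wp_def by (meson exec_Seq add_mono)
qed

lemma wp_Seq_NAssign:
  "wp P T Q (s\<lparr>nmem := update (nmem s) x (map (\<lambda>i. nval i s) is) (nval a s)\<rparr>) \<Longrightarrow>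
   wp (Seq (NAssign x is a) P) (1 + T) Q s"
  by (rule wp_Seq[OF wp_NAssign[where Q = "\<lambda>s'. s' = _"]]) auto

lemma wp_Seq_WAssign:
  "wp P T Q (s\<lparr>wmem := update (wmem s) x (map (\<lambda>i. nval i s) is) (wval a s)\<rparr>) \<Longrightarrow>
   wp (Seq (WAssign x is a) P) (1 + T) Q s"
  by (rule wp_Seq[OF wp_WAssign[where Q = "\<lambda>s'. s' = _"]]) auto

lemma wp_Cond:
  assumes "bval b s \<Longrightarrow> wp P T Q s" "\<not> bval b s \<Longrightarrow> wp P' T Q s"
  shows "wp (Cond b P P') (1 + T) Q s"
  using assms exec_CondTrue exec_CondFalse unfolding wp_def by (metis add_left_mono)

definition For :: "name \<Rightarrow> nexp \<Rightarrow> prog \<Rightarrow> prog" where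
  "For x e P = Seq (NAssign x [] (Num 0))
     (Loop (NLess (NCell x []) e) (Seq P (NAssign x [] (NAdd (NCell x []) (Num 1)))))"

lemma writes_For [simp]: "writes (For x e P) = insert x (writes P)"
  by (auto simp: For_def)

text \<open>The budget is 1 for the initialisation, 1 for the final test, and per round
  \<open>T\<close> plus a test and an increment. Each round must establish the invariant in the
  state after the increment.\<close>

lemma wp_For:
  fixes I :: "nat \<Rightarrow> state \<Rightarrow> bool"
  assumes x: "x \<notin> writes P"
    and init: "I 0 (s\<lparr>nmem := update (nmem s) x [] 0\<rparr>)"
    and step: "\<And>i s'. i < N \<Longrightarrow> I i s' \<Longrightarrow> nmem s' x [] = i \<Longrightarrow> frame (insert x (writes P)) s s' \<Longrightarrow>
      wp P T (\<lambda>s''. I (Suc i) (s''\<lparr>nmem := update (nmem s'') x [] (Suc i)\<rparr>)) s'"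
    and e: "\<And>s'. frame (insert x (writes P)) s s' \<Longrightarrow> nval e s' = N"
  shows "wp (For x e P) (2 + N * (T + 2)) (I N) s"
proof -
  let ?L = "Loop (NLess (NCell x []) e) (Seq P (NAssign x [] (NAdd (NCell x []) (Num 1))))"
  let ?X = "insert x (writes P)"
  have loop: "wp ?L (1 + m * (T + 2)) (I N) s'"
    if "m + i = N" "I i s'" "nmem s' x [] = i" "frame ?X s s'" for m i s'
    using that
  proof (induction m arbitrary: i s')
    case 0
    have "exec ?L s' 1 s'" by (rule exec_LoopFalse) (use 0 e in auto)
    then show ?case unfolding wp_def using 0 by (intro exI[of _ 1] exI[of _ s']) auto
  next
    case (Suc m)
    have "wp P T (\<lambda>s''. I (Suc i) (s''\<lparr>nmem := update (nmem s'') x [] (Suc i)\<rparr>)) s'"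
      by (rule step) (use Suc.prems in auto)
    then obtain t s'' where s'': "exec P s' t s''" "t \<le> T"
      "I (Suc i) (s''\<lparr>nmem := update (nmem s'') x [] (Suc i)\<rparr>)" by (auto simp: wp_def)
    let ?s = "s''\<lparr>nmem := update (nmem s'') x [] (Suc i)\<rparr>"
    have "nmem s'' x = nmem s' x" using frameD(1)[OF exec_frame[OF s''(1)] x] .
    then have ex: "exec (Seq P (NAssign x [] (NAdd (NCell x []) (Num 1)))) s' (t + 1) ?s"
      using exec_Seq[OF s''(1) exec_NAssign[of x "[]" "NAdd (NCell x []) (Num 1)"]] Suc.prems(3) by simp
    have "frame ?X s ?s"
      using frame_trans[OF Suc.prems(4), of ?s] exec_frame[OF ex] by auto
    then have "wp ?L (1 + m * (T + 2)) (I N) ?s"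
      by (intro Suc.IH[of "Suc i"]) (use Suc.prems(1) s''(3) in \<open>auto simp: update_apply\<close>)
    then obtain u s3 where u: "exec ?L ?s u s3" "u \<le> 1 + m * (T + 2)" "I N s3"
      by (auto simp: wp_def)
    have "exec ?L s' (1 + (t + 1) + u) s3"
      by (rule exec_LoopTrue[OF _ ex u(1)]) (use Suc.prems e[OF Suc.prems(4)] in auto)
    then show ?case unfolding wp_def using u s''(2)
      by (intro exI[of _ "1 + (t + 1) + u"] exI[of _ s3]) auto
  qed
  have "wp (For x e P) (1 + (1 + N * (T + 2))) (I N) s"
    unfolding For_def
  proof (rule wp_Seq)
    show "wp (NAssign x [] (Num 0)) 1 (\<lambda>s'. s' = s\<lparr>nmem := update (nmem s) x [] 0\<rparr>) s"
      by (rule wp_NAssign) simp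
    fix s' assume "s' = s\<lparr>nmem := update (nmem s) x [] 0\<rparr>"
    then show "wp ?L (1 + N * (T + 2)) (I N) s'"
      by (intro loop[of N 0]) (use init in \<open>auto simp: update_apply frame_def\<close>)
  qed
  then show ?thesis by simp
qed

section \<open>The greedy partition as a random access program\<close>

section \<open>The program\<close>

abbreviation nvar :: "name \<Rightarrow> nexp" where
  "nvar x \<equiv> NCell x []"

abbreviation for_arcs :: "prog \<Rightarrow> prog" where
  "for_arcs P \<equiv> For ''u'' (nvar ''n'') (For ''v'' (nvar ''n'') P)"

text \<open>Weight cells of non-edges hold 0, so the edge test keeps them from acting as free edges;
  the fault test confines the search to \<open>H\<close>.\<close>

definition relax :: prog where
  "relax = Cond (BAnd (NLess (Num 0) (NCell ''edge'' [nvar ''u'', nvar ''v'']))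
       (BAnd (BNot (NLess (Num 0) (NCell ''fault'' [nvar ''u'', nvar ''v''])))
         (WLess (WAdd (WCell ''dist'' [nvar ''u'']) (WCell ''weight'' [nvar ''u'', nvar ''v'']))
           (WCell ''dist'' [nvar ''v'']))))
     (WAssign ''dist'' [nvar ''v'']
       (WAdd (WCell ''dist'' [nvar ''u'']) (WCell ''weight'' [nvar ''u'', nvar ''v''])))
     Skip"

text \<open>Bellman--Ford in \<open>G - F\<close>. Only distances below \<open>L\<close> matter, so \<open>L\<close> itself serves as infinity.\<close>

definition distances :: "name \<Rightarrow> prog" where
  "distances x = Seq (For ''u'' (nvar ''n'') (WAssign ''dist'' [nvar ''u''] (WCell ''L'' [])))
     (Seq (WAssign ''dist'' [nvar x] WZero)
       (For ''r'' (nvar ''n'') (for_arcs relax)))"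

text \<open>The increment \<open>e\<close> is a parameter because the machine has no multiplication:
  adding \<open>k + k\<close> per arc yields \<open>2 * k\<close> times the size of a ball.\<close>

definition count_arcs :: "name \<Rightarrow> bexp \<Rightarrow> nexp \<Rightarrow> prog" where
  "count_arcs c b e = Seq (NAssign c [] (Num 0))
     (for_arcs (Cond b (NAssign c [] (NAdd (nvar c) e)) Skip))"

definition in_ball :: bexp where
  "in_ball = BAnd (NLess (Num 0) (NCell ''fault'' [nvar ''u'', nvar ''v'']))
     (WLess (WCell ''dist'' [nvar ''u'']) (WCell ''L'' []))"

text \<open>The second branch erases what an earlier ball left in the same row.\<close>

definition store_ball :: prog where
  "store_ball = for_arcs (Cond in_ball
     (NAssign ''out_fault'' [nvar ''out_q'', nvar ''u'', nvar ''v''] (Num 1))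
     (NAssign ''out_fault'' [nvar ''out_q'', nvar ''u'', nvar ''v''] (Num 0)))"

text \<open>The variable \<open>g\<close> holds the number of directed faults, which is at most \<open>2f\<close>; hence the comparison with \<open>2k\<close>
  times the size of the ball.\<close>

definition attempt :: "name \<Rightarrow> prog" where
  "attempt x = Seq (distances x)
     (Seq (count_arcs ''cnt'' in_ball (NAdd (nvar ''k'') (nvar ''k'')))
       (Cond (NLess (nvar ''g'') (nvar ''cnt'')) Skip
         (Seq (NAssign ''ok'' [] (Num 1)) store_ball)))"

definition extend_piece :: prog where
  "extend_piece = Seq (NAssign ''out_path'' [nvar ''out_q'', NCell ''out_len'' [nvar ''out_q'']] (nvar ''y''))
     (NAssign ''out_len'' [nvar ''out_q''] (NAdd (NCell ''out_len'' [nvar ''out_q'']) (Num 1)))"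

definition start_piece :: "nexp \<Rightarrow> prog" where
  "start_piece a = Seq (NAssign ''x'' [] a)
     (Seq (NAssign ''out_path'' [nvar ''out_q'', Num 0] (nvar ''x''))
       (NAssign ''out_len'' [nvar ''out_q''] (Num 1)))"

text \<open>The fault row of the new piece still holds only zeros; the empty fault set is right for
  a single vertex.\<close>

definition cut_piece :: prog where
  "cut_piece = Seq (NAssign ''out_edge'' [nvar ''out_q'', Num 0] (NCell ''path'' [nvar ''j'']))
     (Seq (NAssign ''out_edge'' [nvar ''out_q'', Num 1] (nvar ''y''))
       (Seq (NAssign ''out_q'' [] (NAdd (nvar ''out_q'') (Num 1)))
         (Seq (WAssign ''L'' [] WZero) (start_piece (nvar ''y'')))))"

text \<open>The piece enlarged by \<open>y\<close> is tried with the ball at either end. A failed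
  attempt leaves the fault row alone, so after two failures it still holds the set that serves the
  piece without \<open>y\<close>.\<close>

definition advance :: prog where
  "advance = Seq (NAssign ''y'' [] (NCell ''path'' [NAdd (nvar ''j'') (Num 1)]))
     (Seq (WAssign ''L'' [] (WAdd (WCell ''L'' []) (WCell ''weight'' [NCell ''path'' [nvar ''j''], nvar ''y''])))
       (Seq (NAssign ''ok'' [] (Num 0))
         (Seq (attempt ''x'')
           (Seq (attempt ''y'')
             (Cond (NLess (Num 0) (nvar ''ok'')) extend_piece cut_piece)))))"

definition partition_path :: prog where
  "partition_path = Seq (count_arcs ''g'' (NLess (Num 0) (NCell ''fault'' [nvar ''u'', nvar ''v''])) (Num 1))
     (Seq (start_piece (NCell ''path'' [Num 0]))
       (For ''j'' (NSub (nvar ''len'') (Num 1)) advance))"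

section \<open>Loops over ordered pairs of vertices\<close>

section \<open>Correctness of the subroutines\<close>

lemma writes_attempt:
  "writes (attempt x) = {''u'', ''v'', ''r'', ''dist'', ''cnt'', ''ok'', ''out_fault''}"
  by (auto simp: attempt_def distances_def relax_def count_arcs_def store_ball_def)

text \<open>\<open>I i j\<close> describes the moment when \<open>i\<close> rows and
  \<open>j\<close> entries of the next row are done. It must be insensitive to the cells
  \<open>u\<close> and \<open>v\<close>, which lets the rule absorb the counter updates.\<close>

lemma wp_for_arcs:
  fixes I :: "nat \<Rightarrow> nat \<Rightarrow> state \<Rightarrow> bool"
  assumes w: "''u'' \<notin> writes P" "''v'' \<notin> writes P" "''n'' \<notin> writes P" and n: "nmem s ''n'' [] = n"
    and init: "I 0 0 s"
    and cong: "\<And>i j s' x m. I i j s' \<Longrightarrow> x = ''u'' \<or> x = ''v'' \<Longrightarrow> I i j (s'\<lparr>nmem := update (nmem s') x [] m\<rparr>)"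
    and row: "\<And>i s'. I i n s' \<Longrightarrow> I (Suc i) 0 s'"
    and step: "\<And>i j s'. i < n \<Longrightarrow> j < n \<Longrightarrow> I i j s' \<Longrightarrow> nmem s' ''u'' [] = i \<Longrightarrow> nmem s' ''v'' [] = j \<Longrightarrow>
      frame ({''u'', ''v''} \<union> writes P) s s' \<Longrightarrow> wp P T (I i (Suc j)) s'"
  shows "wp (for_arcs P) (2 + n * (2 + n * (T + 2) + 2)) (I n 0) s"
proof (rule wp_For)
  show "''u'' \<notin> writes (For ''v'' (nvar ''n'') P)" using w by simp
  show "I 0 0 (s\<lparr>nmem := update (nmem s) ''u'' [] 0\<rparr>)" using init cong by blast
  show "nval (nvar ''n'') s' = n" if "frame (insert ''u'' (writes (For ''v'' (nvar ''n'') P))) s s'" for s'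
    using frameD(1)[OF that, of "''n''"] w n by simp
  fix i s' assume i: "i < n" "I i 0 s'" "nmem s' ''u'' [] = i"
    "frame (insert ''u'' (writes (For ''v'' (nvar ''n'') P))) s s'"
  have "wp (For ''v'' (nvar ''n'') P) (2 + n * (T + 2)) (I i n) s'"
  proof (rule wp_For)
    show "I i 0 (s'\<lparr>nmem := update (nmem s') ''v'' [] 0\<rparr>)" using i cong by blast
    show "nval (nvar ''n'') s'' = n" if "frame (insert ''v'' (writes P)) s' s''" for s''
      using frameD(1)[OF that, of "''n''"] frameD(1)[OF i(4), of "''n''"] w n by simp
    fix j s'' assume j: "j < n" "I i j s''" "nmem s'' ''v'' [] = j" "frame (insert ''v'' (writes P)) s' s''"
    have "wp P T (I i (Suc j)) s''"
      by (rule step)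
        (use i j w frameD(1)[OF j(4), of "''u''"] in \<open>auto intro: frame_trans[OF i(4)[simplified]] frame_mono\<close>)
    then show "wp P T (\<lambda>s3. I i (Suc j) (s3\<lparr>nmem := update (nmem s3) ''v'' [] (Suc j)\<rparr>)) s''"
      by (rule wp_mono) (use cong in auto)
  qed (use w in auto)
  then show "wp (For ''v'' (nvar ''n'') P) (2 + n * (T + 2))
      (\<lambda>s''. I (Suc i) 0 (s''\<lparr>nmem := update (nmem s'') ''u'' [] (Suc i)\<rparr>)) s'"
    by (rule wp_mono) (use cong row in auto)
qed

lemma wp_count_arcs:
  assumes n: "nmem s ''n'' [] = n" and c: "c \<notin> {''u'', ''v'', ''n''}"
    and b: "\<And>i j s'. i < n \<Longrightarrow> j < n \<Longrightarrow> frame {''u'', ''v'', c} s s' \<Longrightarrow> nmem s' ''u'' [] = i \<Longrightarrow>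
      nmem s' ''v'' [] = j \<Longrightarrow> bval b s' = B i j \<and> nval e s' = K"
  shows "wp (count_arcs c b e) (1 + (2 + n * (2 + n * (2 + 2) + 2)))
    (\<lambda>s'. nmem s' c [] = K * card {(i, j). i < n \<and> j < n \<and> B i j}) s"
proof -
  define f where "f i j = (if B i j then K else 0)" for i j
  let ?I = "\<lambda>i j s'. nmem s' c [] = (\<Sum>i'<i. \<Sum>j'<n. f i' j') + (\<Sum>j'<j. f i j')"
  have "wp (count_arcs c b e) (1 + (2 + n * (2 + n * (2 + 2) + 2))) (?I n 0) s"
    unfolding count_arcs_def
  proof (rule wp_Seq)
    show "wp (NAssign c [] (Num 0)) 1 (\<lambda>s'. nmem s' c [] = 0) s"
      by (rule wp_NAssign) (simp add: update_apply)
    fix s1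
    assume s1: "nmem s1 c [] = 0" "frame (writes (NAssign c [] (Num 0))) s s1"
    show "wp (for_arcs (Cond b (NAssign c [] (NAdd (nvar c) e)) Skip)) (2 + n * (2 + n * (2 + 2) + 2)) (?I n 0) s1"
    proof (rule wp_for_arcs[where I = ?I])
      fix i j s'
      assume *: "i < n" "j < n" "?I i j s'" "nmem s' ''u'' [] = i" "nmem s' ''v'' [] = j"
        "frame ({''u'', ''v''} \<union> writes (Cond b (NAssign c [] (NAdd (nvar c) e)) Skip)) s1 s'"
      have "frame {''u'', ''v'', c} s s'"
        by (rule frame_trans[of _ _ s1]) (use * s1 in \<open>auto elim: frame_mono\<close>)
      from b[OF *(1,2) this *(4,5)] have "bval b s' = B i j" "nval e s' = K" by auto
      then have "wp (Cond b (NAssign c [] (NAdd (nvar c) e)) Skip) (1 + 1) (?I i (Suc j)) s'"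
        by (intro wp_Cond wp_NAssign wp_Skip) (use *(3) in \<open>auto simp: update_apply f_def\<close>)
      then show "wp (Cond b (NAssign c [] (NAdd (nvar c) e)) Skip) 2 (?I i (Suc j)) s'" by (simp only: one_add_one)
    qed (use c n s1 in \<open>auto simp: update_apply frame_def\<close>)
  qed
  moreover have "(\<Sum>i'<n. \<Sum>j'<n. f i' j') = K * card {(i, j). i < n \<and> j < n \<and> B i j}"
  proof -
    have "(\<Sum>i'<n. \<Sum>j'<n. f i' j') = (\<Sum>x\<in>{..<n} \<times> {..<n}. if x \<in> {(i, j). B i j} then K else 0)"
      by (simp add: sum.cartesian_product f_def case_prod_unfold)
    also have "\<dots> = (\<Sum>x\<in>({..<n} \<times> {..<n}) \<inter> {(i, j). B i j}. K)"
      by (simp add: sum.If_cases)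
    also have "({..<n} \<times> {..<n}) \<inter> {(i, j). B i j} = {(i, j). i < n \<and> j < n \<and> B i j}" by auto
    finally show ?thesis by simp
  qed
  ultimately show ?thesis by simp
qed

lemma wp_store_ball:
  assumes n: "nmem s ''n'' [] = n" and q: "nmem s ''out_q'' [] = q"
    and b: "\<And>i j s'. i < n \<Longrightarrow> j < n \<Longrightarrow> frame {''u'', ''v'', ''out_fault''} s s' \<Longrightarrow> nmem s' ''u'' [] = i \<Longrightarrow>
      nmem s' ''v'' [] = j \<Longrightarrow> bval in_ball s' = B i j"
  shows "wp store_ball (2 + n * (2 + n * (2 + 2) + 2))
    (\<lambda>s'. \<forall>i u v. nmem s' ''out_fault'' [i, u, v] =
      (if i = q \<and> u < n \<and> v < n then of_bool (B u v) else nmem s ''out_fault'' [i, u, v])) s"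
proof -
  \<comment> \<open>Pairs lexicographically before \<open>(a, b)\<close> have been rewritten; all
    other cells hold their old values.\<close>
  let ?I = "\<lambda>a b s'. \<forall>i u v. nmem s' ''out_fault'' [i, u, v] =
      (if i = q \<and> v < n \<and> (u < a \<or> u = a \<and> v < b) then of_bool (B u v) else nmem s ''out_fault'' [i, u, v])"
  let ?P = "Cond in_ball (NAssign ''out_fault'' [nvar ''out_q'', nvar ''u'', nvar ''v''] (Num 1))
     (NAssign ''out_fault'' [nvar ''out_q'', nvar ''u'', nvar ''v''] (Num 0))"
  have "wp store_ball (2 + n * (2 + n * (2 + 2) + 2)) (?I n 0) s"
    unfolding store_ball_def
  proof (rule wp_for_arcs[where I = ?I])
    fix i j s'
    assume *: "i < n" "j < n" "?I i j s'" "nmem s' ''u'' [] = i" "nmem s' ''v'' [] = j"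
      "frame ({''u'', ''v''} \<union> writes ?P) s s'"
    have fr: "frame {''u'', ''v'', ''out_fault''} s s'" using *(6) by (rule frame_mono) auto
    have "nmem s' ''out_q'' [] = q" using frameD(1)[OF fr, of "''out_q''"] q by simp
    with b[OF *(1,2) fr *(4,5)] have "wp ?P (1 + 1) (?I i (Suc j)) s'"
      by (intro wp_Cond wp_NAssign) (use * in \<open>auto simp: update_apply less_Suc_eq\<close>)
    then show "wp ?P 2 (?I i (Suc j)) s'" by (simp only: one_add_one)
  qed (use n in \<open>auto simp: update_apply less_Suc_eq\<close>)
  then show ?thesis by (rule wp_mono) auto
qed

section \<open>Bellman-Ford distances truncated at the radius\<close>

context replacement_path
begin

text \<open>The facts about input cells on which the program relies; unlike
  \<open>input_state\<close>, they survive writes to other arrays.\<close>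

definition inputs :: "nat \<Rightarrow> state \<Rightarrow> bool" where
  "inputs k s \<longleftrightarrow> nmem s ''n'' [] = nverts G \<and> nmem s ''k'' [] = k \<and> nmem s ''len'' [] = length p \<and>
     (\<forall>i<length p. nmem s ''path'' [i] = p ! i) \<and>
     (\<forall>u v. nmem s ''edge'' [u, v] = of_bool ({u, v} \<in> edges G)) \<and>
     (\<forall>u v. nmem s ''fault'' [u, v] = of_bool ({u, v} \<in> F)) \<and>
     (\<forall>u v. {u, v} \<in> edges G \<longrightarrow> wmem s ''weight'' [u, v] = weight G {u, v})"

lemma inputs_frame:
  assumes "frame X s s'" "X \<inter> {''n'', ''k'', ''len'', ''path'', ''edge'', ''fault'', ''weight''} = {}" "inputs k s"
  shows "inputs k s'"
proof -
  have "nmem s' x = nmem s x \<and> wmem s' x = wmem s x"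
    if "x \<in> {''n'', ''k'', ''len'', ''path'', ''edge'', ''fault'', ''weight''}" for x
    using assms(1,2) that unfolding frame_def by blast
  then show ?thesis using assms(3) by (simp add: inputs_def)
qed

text \<open>\<open>L\<close> plays the role of infinity: an estimate of at least \<open>L\<close>
  claims nothing.\<close>

definition sound :: "nat \<Rightarrow> real \<Rightarrow> (nat \<Rightarrow> real) \<Rightarrow> bool" where
  "sound z L d \<longleftrightarrow> (\<forall>v<nverts G. d v < L \<longrightarrow> (\<exists>r. walk H r z v (d v)))"

definition complete :: "nat \<Rightarrow> nat \<Rightarrow> (nat \<Rightarrow> real) \<Rightarrow> bool" where
  "complete z r d \<longleftrightarrow> (\<forall>v r' l. r' \<le> r \<longrightarrow> walk H r' z v l \<longrightarrow> d v \<le> l)"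

text \<open>Progress within a round, in row-major order of the pairs. The bound refers to walk
  lengths rather than to the current \<open>d u\<close>, so later decreases of \<open>d\<close>
  cannot destroy it.\<close>

definition relaxed :: "nat \<Rightarrow> nat \<Rightarrow> (nat \<Rightarrow> real) \<Rightarrow> nat \<Rightarrow> nat \<Rightarrow> bool" where
  "relaxed z r d i j \<longleftrightarrow> (\<forall>u v r' l. (u < i \<or> u = i \<and> v < j) \<longrightarrow> r' \<le> r \<longrightarrow> walk H r' z u l \<longrightarrow>
     {u, v} \<in> edges H \<longrightarrow> d v \<le> l + weight G {u, v})"

lemma relaxed_row: "relaxed z r d i (nverts G) \<Longrightarrow> relaxed z r d (Suc i) 0"
  using weighted_graph_edgeD(2)[OF wgH] unfolding relaxed_def less_Suc_eq by auto

lemma relaxed_imp_complete: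
  assumes "complete z r d" "relaxed z r d (nverts G) 0"
  shows "complete z (Suc r) d"
  unfolding complete_def
proof (intro allI impI)
  fix v r' l
  assume "r' \<le> Suc r" "walk H r' z v l"
  from this(2,1) show "d v \<le> l"
  proof cases
    case walk_refl
    then show ?thesis using assms(1) walk.walk_refl[of z H] unfolding complete_def by blast
  next
    case (walk_step r1 u l1)
    then show ?thesis
      using assms(2) walk_verts(2)[OF wgH walk_step(3)] \<open>r' \<le> Suc r\<close> unfolding relaxed_def by simp
  qed
qed

lemma relax_keep:
  assumes "complete z r d" "relaxed z r d i j" "{i, j} \<in> edges H \<Longrightarrow> d j \<le> d i + weight G {i, j}"
  shows "relaxed z r d i (Suc j)"
  using assms unfolding relaxed_def complete_def less_Suc_eq by (fastforce intro: order_trans)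

text \<open>\<open>complete\<close> and \<open>relaxed\<close> only bound \<open>d\<close> from
  above, so lowering an estimate preserves them; soundness comes from appending the edge to a walk
  that ends in \<open>i\<close>.\<close>

lemma relax_update:
  assumes ij: "{i, j} \<in> edges H" "d i + weight G {i, j} < d j"
    and d: "sound z L d" "complete z r d" "relaxed z r d i j"
  defines "d' \<equiv> d(j := d i + weight G {i, j})"
  shows "sound z L d'" "complete z r d'" "relaxed z r d' i (Suc j)"
proof -
  have le: "d' v \<le> d v" for v using ij by (simp add: d'_def)
  have w: "0 \<le> weight G {i, j}" "i < nverts G" using weighted_graph_edgeD[OF wgH ij(1)] by simp_all
  show "sound z L d'"
    unfolding sound_def
  proof (intro allI impI)
    fix v assume v: "v < nverts G" "d' v < L"
    show "\<exists>r. walk H r z v (d' v)"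
    proof (cases "v = j")
      case True
      \<comment> \<open>Weights are nonnegative, so the estimate of \<open>i\<close> is below
        \<open>L\<close> too and belongs to a genuine walk.\<close>
      then have "d i < L" using v w by (simp add: d'_def)
      then obtain r where "walk H r z i (d i)" using d(1) w by (auto simp: sound_def)
      from walk_step[OF this ij(1)] show ?thesis using True by (auto simp: d'_def)
    next
      case False
      then show ?thesis using d(1) v by (simp add: sound_def d'_def)
    qed
  qed
  show c: "complete z r d'"
    using d(2) unfolding complete_def by (blast intro: order_trans[OF le])
  have "relaxed z r d' i j"
    using d(3) unfolding relaxed_def by (blast intro: order_trans[OF le])
  moreover have "d' j \<le> d' i + weight G {i, j}" using w ij by (auto simp: d'_def)
  ultimately show "relaxed z r d' i (Suc j)" by (intro relax_keep c)
qed

text \<open>A ball only asks which vertices are closer than \<open>L\<close>, so the specification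
  speaks of this test and not of the distances.\<close>

lemma wp_distances:
  assumes s: "inputs k s" and z: "nmem s x [] = z" "z < nverts G" and L: "wmem s ''L'' [] = L"
    and x: "x \<in> {''x'', ''y''}"
  shows "wp (distances x)
    (2 + nverts G * (1 + 2) + (1 + (2 + nverts G * (2 + nverts G * (2 + nverts G * (2 + 2) + 2) + 2))))
    (\<lambda>s'. \<forall>u<nverts G. wmem s' ''dist'' [u] < L \<longleftrightarrow> (\<exists>r l. walk H r z u l \<and> l < L)) s"
proof -
  let ?n = "nverts G"
  let ?d = "\<lambda>s' v. wmem s' ''dist'' [v]"
  let ?S = "\<lambda>r s'. sound z L (?d s') \<and> complete z r (?d s')"
  have "wp (distances x) (2 + ?n * (1 + 2) + (1 + (2 + ?n * (2 + ?n * (2 + ?n * (2 + 2) + 2) + 2)))) (?S ?n) s"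
    unfolding distances_def
  proof (rule wp_Seq)
    show "wp (For ''u'' (nvar ''n'') (WAssign ''dist'' [nvar ''u''] (WCell ''L'' []))) (2 + ?n * (1 + 2))
      (\<lambda>s'. \<forall>v<?n. ?d s' v = L) s"
    proof (rule wp_For[where I = "\<lambda>i s'. \<forall>v<i. ?d s' v = L"])
      fix i s' assume "i < ?n" "\<forall>v<i. ?d s' v = L" "nmem s' ''u'' [] = i"
        "frame (insert ''u'' (writes (WAssign ''dist'' [nvar ''u''] (WCell ''L'' [])))) s s'"
      then show "wp (WAssign ''dist'' [nvar ''u''] (WCell ''L'' [])) 1
        (\<lambda>s''. \<forall>v<Suc i. ?d (s''\<lparr>nmem := update (nmem s'') ''u'' [] (Suc i)\<rparr>) v = L) s'"
        by (intro wp_WAssign) (use L in \<open>auto simp: update_apply frame_def less_Suc_eq\<close>)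
    qed (use s in \<open>auto simp: frame_def inputs_def\<close>)
  next
    fix s1 assume s1: "\<forall>v<?n. ?d s1 v = L"
      "frame (writes (For ''u'' (nvar ''n'') (WAssign ''dist'' [nvar ''u''] (WCell ''L'' [])))) s s1"
    have "x \<notin> writes (For ''u'' (nvar ''n'') (WAssign ''dist'' [nvar ''u''] (WCell ''L'' [])))"
      using x by auto
    with frameD(1)[OF s1(2)] z(1) have z1: "nmem s1 x [] = z" by simp
    \<comment> \<open>All estimates except that of \<open>z\<close> start at \<open>L\<close>, where
      soundness is vacuous; \<open>z\<close> has the empty walk.\<close>
    have "sound z L (?d (s1\<lparr>wmem := update (wmem s1) ''dist'' [z] 0\<rparr>))"
      using s1 walk_refl[of z H] z by (auto simp: sound_def update_apply)
    moreover have "complete z 0 (?d (s1\<lparr>wmem := update (wmem s1) ''dist'' [z] 0\<rparr>))"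
      using walk_0[of H] by (auto simp: complete_def update_apply)
    ultimately have init: "wp (WAssign ''dist'' [nvar x] WZero) 1 (?S 0) s1"
      by (intro wp_WAssign) (simp add: z1)
    have rounds: "wp (For ''r'' (nvar ''n'') (for_arcs relax)) (2 + ?n * (2 + ?n * (2 + ?n * (2 + 2) + 2) + 2)) (?S ?n) s2"
      if s2: "?S 0 s2" "frame (writes (WAssign ''dist'' [nvar x] WZero)) s1 s2" for s2
    proof -
      have i2: "inputs k s2"
        by (rule inputs_frame[OF s2(2) _ inputs_frame[OF s1(2) _ s]]) auto
      show ?thesis
      proof (rule wp_For[where I = ?S])
        fix r s3 assume s3: "r < ?n" "?S r s3" "nmem s3 ''r'' [] = r"
          "frame (insert ''r'' (writes (for_arcs relax))) s2 s3"
        have i3: "inputs k s3" by (rule inputs_frame[OF s3(4) _ i2]) (auto simp: relax_def)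
        let ?I = "\<lambda>i j s'. ?S r s' \<and> relaxed z r (?d s') i j"
        have "wp (for_arcs relax) (2 + ?n * (2 + ?n * (2 + 2) + 2)) (?I ?n 0) s3"
        proof (rule wp_for_arcs[where I = ?I])
          fix i j s4 assume s4: "i < ?n" "j < ?n" "?I i j s4" "nmem s4 ''u'' [] = i" "nmem s4 ''v'' [] = j"
            "frame ({''u'', ''v''} \<union> writes relax) s3 s4"
          have i4: "inputs k s4" by (rule inputs_frame[OF s4(6) _ i3]) (auto simp: relax_def)
          let ?D = "?d s4"
          have upd: "(\<lambda>v. update (wmem s4) ''dist'' [j] a ''dist'' [v]) = ?D(j := a)" for a
            by (auto simp: update_apply fun_eq_iff)
          have "wp relax (1 + 1) (?I i (Suc j)) s4"
            unfolding relax_def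
          proof (rule wp_Cond, goal_cases)
            case 1
            then have e: "{i, j} \<in> edges H" "?D i + weight G {i, j} < ?D j" "wmem s4 ''weight'' [i, j] = weight G {i, j}"
              using i4 s4 by (auto simp: inputs_def)
            show ?case
              by (rule wp_WAssign)
                (use relax_update[OF e(1,2), of z L r] s4(3) in \<open>simp add: s4(4,5) e(3) upd del: del_edges_simps\<close>)
          next
            case 2
            then have "?D j \<le> ?D i + weight G {i, j}" if "{i, j} \<in> edges H"
              using i4 s4 that by (auto simp: inputs_def)
            then show ?case by (intro wp_Skip) (use s4(3) relax_keep in blast)
          qed
          then show "wp relax 2 (?I i (Suc j)) s4" by (simp only: one_add_one)
        next
          show "?I 0 0 s3" using s3(2) by (simp add: relaxed_def)
        next
          fix i s' assume "?I i ?n s'" then show "?I (Suc i) 0 s'" using relaxed_row by blast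
        qed (use i3 in \<open>auto simp: relax_def inputs_def\<close>)
        then show "wp (for_arcs relax) (2 + ?n * (2 + ?n * (2 + 2) + 2))
          (\<lambda>s''. ?S (Suc r) (s''\<lparr>nmem := update (nmem s'') ''r'' [] (Suc r)\<rparr>)) s3"
          by (rule wp_mono) (auto intro: relaxed_imp_complete)
      next
        fix s' assume "frame (insert ''r'' (writes (for_arcs relax))) s2 s'"
        from inputs_frame[OF this _ i2] show "nval (nvar ''n'') s' = ?n"
          by (auto simp: relax_def inputs_def)
      qed (use s2 in \<open>auto simp: relax_def\<close>)
    qed
    show "wp (Seq (WAssign ''dist'' [nvar x] WZero) (For ''r'' (nvar ''n'') (for_arcs relax)))
      (1 + (2 + ?n * (2 + ?n * (2 + ?n * (2 + 2) + 2) + 2))) (?S ?n) s1"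
      using init rounds by (rule wp_Seq)
  qed
  then show ?thesis
  proof (rule wp_mono[OF _ order_refl], intro allI impI)
    fix s' u assume S: "?S ?n s'" and u: "u < ?n"
    show "?d s' u < L \<longleftrightarrow> (\<exists>r l. walk H r z u l \<and> l < L)"
    proof
      assume "?d s' u < L"
      moreover from this obtain r where "walk H r z u (?d s' u)" using S u by (auto simp: sound_def)
      ultimately show "\<exists>r l. walk H r z u l \<and> l < L" by blast
    next
      assume "\<exists>r l. walk H r z u l \<and> l < L"
      then obtain r l where "walk H r z u l" "l < L" by blast
      then obtain r' l' where "r' \<le> nverts H" "l' \<le> l" "walk H r' z u l'"
        by (auto elim: short_walk[OF wgH])
      then have "?d s' u \<le> l'" using S by (simp add: complete_def)
      then show "?d s' u < L" using \<open>l' \<le> l\<close> \<open>l < L\<close> by linarith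
    qed
  qed
qed

end

section \<open>Testing and storing one ball\<close>

definition fault_arcs :: "state \<Rightarrow> nat \<Rightarrow> (nat \<times> nat) set" where
  "fault_arcs s i = {(u, v). nmem s ''out_fault'' [i, u, v] = 1}"

text \<open>The time bounds keep the nesting of the program so that they match the rules literally;
  they are simplified only in \<open>partition_time\<close>.\<close>

abbreviation for_arcs_time :: "nat \<Rightarrow> nat" where
  "for_arcs_time n \<equiv> 2 + n * (2 + n * (2 + 2) + 2)"

abbreviation attempt_time :: "nat \<Rightarrow> nat" where
  "attempt_time n \<equiv> (2 + n * (1 + 2) + (1 + (2 + n * (for_arcs_time n + 2)))) +
     ((1 + for_arcs_time n) + (1 + (1 + for_arcs_time n)))"

context replacement_path
begin

lemma in_ball_iff:
  assumes "inputs k s" "\<And>u. u < nverts G \<Longrightarrow> wmem s ''dist'' [u] < L \<longleftrightarrow> (\<exists>r l. walk H r z u l \<and> l < L)"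
    "wmem s ''L'' [] = L" "nmem s ''u'' [] = i" "nmem s ''v'' [] = j" "i < nverts G"
  shows "bval in_ball s \<longleftrightarrow> (i, j) \<in> ball z L"
  using assms by (simp add: in_ball_def inputs_def ball_def)

lemma ball_bounded: "{(u, v). u < nverts G \<and> v < nverts G \<and> (u, v) \<in> ball z L} = ball z L"
  using ball_subset_arcs arcs_subset by fastforce

text \<open>Since \<open>store_ball\<close> rewrites only indices below \<open>nverts G\<close>, a
  stray 1 outside this block would survive; \<open>bounded\<close> excludes it.\<close>

lemma wp_attempt:
  assumes s: "inputs k s" and z: "nmem s x [] = z" "z < nverts G" and L: "wmem s ''L'' [] = L"
    and x: "x \<in> {''x'', ''y''}" and g: "nmem s ''g'' [] = card arcs" and q: "nmem s ''out_q'' [] = q"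
    and bounded: "fault_arcs s q \<subseteq> {..<nverts G} \<times> {..<nverts G}"
  shows "wp (attempt x) (attempt_time (nverts G)) (\<lambda>s'.
    (if 2 * k * card (ball z L) \<le> card arcs then nmem s' ''ok'' [] = 1 \<and> fault_arcs s' q = ball z L
     else nmem s' ''ok'' [] = nmem s ''ok'' [] \<and> fault_arcs s' q = fault_arcs s q) \<and>
    (\<forall>i. i \<noteq> q \<longrightarrow> fault_arcs s' i = fault_arcs s i)) s" (is "wp _ _ ?Q s")
proof -
  let ?n = "nverts G"
  let ?near = "\<lambda>s'. \<forall>u<?n. wmem s' ''dist'' [u] < L \<longleftrightarrow> (\<exists>r l. walk H r z u l \<and> l < L)"
  have rest: "wp (Seq (count_arcs ''cnt'' in_ball (NAdd (nvar ''k'') (nvar ''k'')))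
       (Cond (NLess (nvar ''g'') (nvar ''cnt'')) Skip (Seq (NAssign ''ok'' [] (Num 1)) store_ball)))
      ((1 + for_arcs_time ?n) + (1 + (1 + for_arcs_time ?n))) ?Q s1"
    if s1: "?near s1" "frame (writes (distances x)) s s1" for s1
  proof -
    have fr1: "frame {''u'', ''v'', ''r'', ''dist''} s s1"
      using s1(2) by (rule frame_mono) (auto simp: distances_def relax_def)
    have ball: "bval in_ball s' \<longleftrightarrow> (i, j) \<in> ball z L" and inp: "inputs k s'"
      if "frame {''u'', ''v'', ''cnt'', ''ok'', ''out_fault''} s1 s'" "i < ?n" "nmem s' ''u'' [] = i" "nmem s' ''v'' [] = j"
      for s' i j
    proof -
      have fr: "frame {''u'', ''v'', ''r'', ''dist'', ''cnt'', ''ok'', ''out_fault''} s s'"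
        by (rule frame_trans[OF frame_mono[OF fr1] frame_mono[OF that(1)]]) auto
      show inp: "inputs k s'" by (rule inputs_frame[OF fr _ s]) simp
      show "bval in_ball s' \<longleftrightarrow> (i, j) \<in> ball z L"
        by (rule in_ball_iff[OF inp _ _ that(3,4,2)])
          (use s1(1) L frameD(2)[OF that(1), of "''dist''"] frameD(2)[OF fr, of "''L''"] in auto)
    qed
    show ?thesis
    proof (rule wp_Seq)
      show "wp (count_arcs ''cnt'' in_ball (NAdd (nvar ''k'') (nvar ''k''))) (1 + for_arcs_time ?n)
        (\<lambda>s'. nmem s' ''cnt'' [] = (k + k) * card {(i, j). i < ?n \<and> j < ?n \<and> (i, j) \<in> ball z L}) s1"
      proof (rule wp_count_arcs)
        show "nmem s1 ''n'' [] = ?n"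
          using frameD(1)[OF fr1, of "''n''"] s by (simp add: inputs_def)
        fix i j s'
        assume *: "i < ?n" "j < ?n" "frame {''u'', ''v'', ''cnt''} s1 s'" "nmem s' ''u'' [] = i" "nmem s' ''v'' [] = j"
        have "frame {''u'', ''v'', ''cnt'', ''ok'', ''out_fault''} s1 s'"
          using *(3) by (rule frame_mono) auto
        from ball[OF this *(1,4,5)] inp[OF this *(1,4,5)]
        show "bval in_ball s' = ((i, j) \<in> ball z L) \<and> nval (NAdd (nvar ''k'') (nvar ''k'')) s' = k + k"
          by (simp add: inputs_def)
      qed simp
    next
      fix s2
      assume cnt: "nmem s2 ''cnt'' [] = (k + k) * card {(i, j). i < ?n \<and> j < ?n \<and> (i, j) \<in> ball z L}"
        and "frame (writes (count_arcs ''cnt'' in_ball (NAdd (nvar ''k'') (nvar ''k'')))) s1 s2"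
      then have fr2: "frame {''u'', ''v'', ''cnt''} s1 s2"
        by (elim frame_mono) (auto simp: count_arcs_def)
      have fr: "frame {''u'', ''v'', ''r'', ''dist'', ''cnt''} s s2"
        by (rule frame_trans[OF frame_mono[OF fr1] frame_mono[OF fr2]]) auto
      have vals: "nmem s2 ''g'' [] = card arcs" "nmem s2 ''cnt'' [] = 2 * k * card (ball z L)"
        "nmem s2 ''ok'' = nmem s ''ok''" "nmem s2 ''out_fault'' = nmem s ''out_fault''"
        "nmem s2 ''n'' [] = ?n" "nmem s2 ''out_q'' [] = q"
        using g q s cnt by (simp_all add: frameD[OF fr] ball_bounded mult_2 inputs_def)
      show "wp (Cond (NLess (nvar ''g'') (nvar ''cnt'')) Skip (Seq (NAssign ''ok'' [] (Num 1)) store_ball))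
        (1 + (1 + for_arcs_time ?n)) ?Q s2"
      proof (rule wp_Cond)
        assume "bval (NLess (nvar ''g'') (nvar ''cnt'')) s2"
        then have "wp Skip 1 ?Q s2" by (intro wp_Skip) (simp add: vals fault_arcs_def)
        then show "wp Skip (1 + for_arcs_time ?n) ?Q s2" by (rule wp_mono) auto
      next
        assume "\<not> bval (NLess (nvar ''g'') (nvar ''cnt'')) s2"
        then have le: "2 * k * card (ball z L) \<le> card arcs" by (simp add: vals)
        show "wp (Seq (NAssign ''ok'' [] (Num 1)) store_ball) (1 + for_arcs_time ?n) ?Q s2"
        proof (rule wp_Seq)
          let ?s3 = "s2\<lparr>nmem := update (nmem s2) ''ok'' [] 1\<rparr>"
          show "wp (NAssign ''ok'' [] (Num 1)) 1 (\<lambda>s'. s' = ?s3) s2"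
            by (rule wp_NAssign) simp
          fix s3 assume s3: "s3 = ?s3"
          have fr3: "frame {''ok''} s2 s3" by (simp add: s3 frame_def update_apply)
          have "wp store_ball (for_arcs_time ?n) (\<lambda>s'. \<forall>i u v. nmem s' ''out_fault'' [i, u, v] =
            (if i = q \<and> u < ?n \<and> v < ?n then of_bool ((u, v) \<in> ball z L) else nmem s3 ''out_fault'' [i, u, v])) s3"
          proof (rule wp_store_ball)
            fix i j s'
            assume *: "i < ?n" "frame {''u'', ''v'', ''out_fault''} s3 s'" "nmem s' ''u'' [] = i" "nmem s' ''v'' [] = j"
            have "frame {''u'', ''v'', ''cnt'', ''ok'', ''out_fault''} s1 s'"
              by (rule frame_trans[OF frame_mono[OF fr2] frame_trans[OF frame_mono[OF fr3] frame_mono[OF *(2)]]]) auto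
            from ball[OF this *(1,3,4)] show "bval in_ball s' = ((i, j) \<in> ball z L)" .
          qed (simp_all add: frameD[OF fr3] vals)
          then show "wp store_ball (for_arcs_time ?n) ?Q s3"
          proof (rule wp_mono[OF _ order_refl])
            fix s'
            assume st: "\<forall>i u v. nmem s' ''out_fault'' [i, u, v] =
              (if i = q \<and> u < ?n \<and> v < ?n then of_bool ((u, v) \<in> ball z L) else nmem s3 ''out_fault'' [i, u, v])"
              and "frame (writes store_ball) s3 s'"
            then have "nmem s' ''ok'' = nmem s3 ''ok''" by (intro frameD(1)) (auto simp: store_ball_def)
            then have ok: "nmem s' ''ok'' [] = 1" by (simp add: s3 update_apply)
            have of3: "nmem s3 ''out_fault'' = nmem s ''out_fault''" by (simp add: s3 update_apply vals)
            have "(u, v) \<in> fault_arcs s' q \<longleftrightarrow> (u, v) \<in> ball z L" for u v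
            proof (cases "u < ?n \<and> v < ?n")
              case True
              then show ?thesis using st by (simp add: fault_arcs_def)
            next
              case False
              then have "(u, v) \<notin> ball z L" "(u, v) \<notin> fault_arcs s q"
                using bounded ball_subset_arcs arcs_subset by blast+
              then show ?thesis using False st by (auto simp: fault_arcs_def of3)
            qed
            then have "fault_arcs s' q = ball z L" by auto
            moreover have "fault_arcs s' i = fault_arcs s i" if "i \<noteq> q" for i
              using st that by (simp add: fault_arcs_def of3)
            ultimately show "?Q s'" using le ok by simp
          qed
        qed
      qed
    qed
  qed
  show ?thesis
    unfolding attempt_def
    by (rule wp_Seq[OF wp_distances[OF s z L x] rest])
qed

end

section \<open>The invariant of the greedy partition\<close>

section \<open>The greedy loop\<close>

abbreviation advance_time :: "nat \<Rightarrow> nat" where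
  "advance_time n \<equiv> 1 + (1 + (1 + (attempt_time n + (attempt_time n + (1 + (1 + (1 + (1 + (1 + (1 + (1 + 1)))))))))))"

abbreviation edge_set :: "(nat \<times> nat) set \<Rightarrow> nat set set" where
  "edge_set S \<equiv> (\<lambda>(u, v). {u, v}) ` S"

context replacement_path
begin

definition good :: "nat \<Rightarrow> (nat \<times> nat) set \<Rightarrow> nat \<Rightarrow> nat \<Rightarrow> bool" where
  "good k S a b \<longleftrightarrow> S \<subseteq> arcs \<and> 2 * k * card S \<le> card arcs \<and>
     shortest_path (del_edges G (edge_set S)) (map ((!) p) [a..<Suc b])"

text \<open>Applied with \<open>b\<close> the first position after a closed piece, that is, the next
  cut. The failing intervals thus run from cut to cut, while \<open>good\<close> for that piece ends
  at \<open>b - 1\<close>.\<close>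

definition failing :: "nat \<Rightarrow> nat \<Rightarrow> nat \<Rightarrow> bool" where
  "failing k a b \<longleftrightarrow> card arcs < 2 * k * card (ball (p ! a) (pos b - pos a)) \<and>
     card arcs < 2 * k * card (ball (p ! b) (pos b - pos a))"

text \<open>Piece \<open>i\<close> occupies the positions \<open>c i, \<dots>, c (i + 1) - 1\<close> of \<open>p\<close>. The last piece \<open>q\<close> is still open, so
  \<open>c (q + 1)\<close> moves as the loop advances.\<close>

definition pieces :: "nat \<Rightarrow> nat \<Rightarrow> (nat \<Rightarrow> nat) \<Rightarrow> nat \<Rightarrow> state \<Rightarrow> bool" where
  "pieces k j c q s \<longleftrightarrow> nmem s ''out_q'' [] = q \<and> c 0 = 0 \<and> c (Suc q) = Suc j \<and>
     nmem s ''x'' [] = p ! c q \<and>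
     (\<forall>i\<le>q. c i < c (Suc i) \<and> nmem s ''out_len'' [i] = c (Suc i) - c i \<and>
        (\<forall>m. c i + m < c (Suc i) \<longrightarrow> nmem s ''out_path'' [i, m] = p ! (c i + m))) \<and>
     (\<forall>i<q. nmem s ''out_edge'' [i, 0] = p ! (c (Suc i) - 1) \<and>
        nmem s ''out_edge'' [i, 1] = p ! c (Suc i) \<and>
        good k (fault_arcs s i) (c i) (c (Suc i) - 1) \<and> failing k (c i) (c (Suc i))) \<and>
     (\<forall>i>q. fault_arcs s i = {})"

text \<open>The cuts \<open>c\<close> exist only in the proof. \<open>L\<close> holds the length of
  the open piece; the loop counter enters as the parameter \<open>j\<close> and not as a
  cell.\<close>

definition invariant :: "nat \<Rightarrow> nat \<Rightarrow> state \<Rightarrow> bool" where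
  "invariant k j s \<longleftrightarrow> inputs k s \<and> nmem s ''g'' [] = card arcs \<and>
     (\<exists>c q. pieces k j c q s \<and> good k (fault_arcs s q) (c q) j \<and> wmem s ''L'' [] = pos j - pos (c q))"

text \<open>The fault row \<open>q\<close> may change, because \<open>pieces\<close> constrains only
  the rows of closed and of future pieces.\<close>

lemma pieces_cong:
  assumes "pieces k j c q s" "frame X s s'" "X \<inter> {''out_q'', ''x'', ''out_len'', ''out_path'', ''out_edge''} = {}"
    "\<And>i. i \<noteq> q \<Longrightarrow> fault_arcs s' i = fault_arcs s i"
  shows "pieces k j c q s'"
proof -
  have "nmem s' x = nmem s x" if "x \<in> {''out_q'', ''x'', ''out_len'', ''out_path'', ''out_edge''}" for x
    using assms(2,3) that unfolding frame_def by blast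
  then show ?thesis using assms(1,4) by (simp add: pieces_def)
qed

lemma good_ball:
  assumes "a \<le> b" "b < length p" "z = p ! a \<or> z = p ! b"
    "2 * k * card (ball z (pos b - pos a)) \<le> card arcs"
  shows "good k (ball z (pos b - pos a)) a b"
  unfolding good_def using shortest_piece[OF assms(1-3)] assms(4) ball_subset_arcs by blast

text \<open>Lengths are nonnegative and balls are strict, so radius 0 gives the empty ball. This
  covers a piece that has just been opened.\<close>

lemma good_empty:
  assumes "a < length p"
  shows "good k {} a a"
proof -
  have "ball (p ! a) (pos a - pos a) = {}"
    using walk_nonneg[OF wgH] by (fastforce simp: ball_def)
  then show ?thesis using good_ball[of a a "p ! a" k] assms by simp
qed

lemma wp_start_piece:
  assumes "Q (s\<lparr>nmem := update (update (update (nmem s) ''x'' [] (nval a s))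
      ''out_path'' [nmem s ''out_q'' [], 0] (nval a s)) ''out_len'' [nmem s ''out_q'' []] 1\<rparr>)"
  shows "wp (start_piece a) (1 + (1 + 1)) Q s"
  unfolding start_piece_def
  by (intro wp_Seq_NAssign wp_NAssign) (use assms in \<open>simp add: update_apply\<close>)

lemma wp_extend_piece:
  assumes s: "pieces k j c q s" "nmem s ''y'' [] = p ! Suc j"
  shows "wp extend_piece (1 + 1) (pieces k (Suc j) (c(Suc q := Suc (Suc j))) q) s"
proof -
  let ?c = "c(Suc q := Suc (Suc j))"
  have q: "nmem s ''out_q'' [] = q" "nmem s ''out_len'' [q] = Suc j - c q" "c q \<le> j"
    using s(1) by (auto simp: pieces_def)
  define s' where "s' = s\<lparr>nmem := update (update (nmem s) ''out_path'' [q, Suc j - c q] (p ! Suc j))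
    ''out_len'' [q] (Suc (Suc j - c q))\<rparr>"
  have fa: "fault_arcs s' i = fault_arcs s i" for i
    by (simp add: fault_arcs_def s'_def update_apply)
  have "?c i < ?c (Suc i) \<and> nmem s' ''out_len'' [i] = ?c (Suc i) - ?c i \<and>
        (\<forall>m. ?c i + m < ?c (Suc i) \<longrightarrow> nmem s' ''out_path'' [i, m] = p ! (?c i + m))" if "i \<le> q" for i
  proof (cases "i = q")
    case True
    have "nmem s ''out_path'' [q, m] = p ! (c q + m)" if "c q + m < Suc j" for m
      using s(1) that by (auto simp: pieces_def)
    then show ?thesis using True q(3) by (auto simp: s'_def update_apply less_Suc_eq)
  next
    case False
    then have i: "i \<noteq> Suc q" "Suc i \<noteq> Suc q" "i \<noteq> q" using that by auto
    then show ?thesis using s(1) that by (simp add: pieces_def s'_def update_apply)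
  qed
  then have "pieces k (Suc j) ?c q s'"
    using s(1) unfolding pieces_def fa by (simp add: s'_def update_apply)
  then show ?thesis
    unfolding extend_piece_def
    by (intro wp_Seq_NAssign wp_NAssign) (simp add: update_apply q s s'_def)
qed

text \<open>Closing a piece combines the set stored before the failed attempts with the failure of
  the piece enlarged by position \<open>Suc j\<close>, which becomes the next cut.\<close>

lemma wp_cut_piece:
  assumes s: "pieces k j c q s" "nmem s ''y'' [] = p ! Suc j" "nmem s ''j'' [] = j" "nmem s ''path'' [j] = p ! j"
    and good: "good k (fault_arcs s q) (c q) j" and fail: "failing k (c q) (Suc j)"
  shows "wp cut_piece (1 + (1 + (1 + (1 + (1 + (1 + 1))))))
    (\<lambda>s'. pieces k (Suc j) (c(Suc (Suc q) := Suc (Suc j))) (Suc q) s' \<and> fault_arcs s' (Suc q) = {} \<and>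
      wmem s' ''L'' [] = 0) s"
proof -
  let ?c = "c(Suc (Suc q) := Suc (Suc j))"
  have q: "nmem s ''out_q'' [] = q" "c q \<le> j" "c (Suc q) = Suc j"
    using s(1) by (auto simp: pieces_def)
  define s' where "s' = s\<lparr>wmem := update (wmem s) ''L'' [] 0,
    nmem := update (update (update (update (update (update (nmem s)
    ''out_edge'' [q, 0] (p ! j)) ''out_edge'' [q, 1] (p ! Suc j)) ''out_q'' [] (Suc q)) ''x'' [] (p ! Suc j))
    ''out_path'' [Suc q, 0] (p ! Suc j)) ''out_len'' [Suc q] 1\<rparr>"
  have fa: "fault_arcs s' i = fault_arcs s i" for i
    by (simp add: fault_arcs_def s'_def update_apply)
  have "?c i < ?c (Suc i) \<and> nmem s' ''out_len'' [i] = ?c (Suc i) - ?c i \<and>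
        (\<forall>m. ?c i + m < ?c (Suc i) \<longrightarrow> nmem s' ''out_path'' [i, m] = p ! (?c i + m))" if "i \<le> Suc q" for i
  proof (cases "i = Suc q")
    case True
    then show ?thesis using q(3) by (auto simp: s'_def update_apply)
  next
    case False
    then have i: "i \<noteq> Suc (Suc q)" "Suc i \<noteq> Suc (Suc q)" "i \<le> q" using that by auto
    then show ?thesis using s(1) False by (simp add: pieces_def s'_def update_apply)
  qed
  moreover have "nmem s' ''out_edge'' [i, 0] = p ! (?c (Suc i) - 1) \<and>
        nmem s' ''out_edge'' [i, 1] = p ! ?c (Suc i) \<and>
        good k (fault_arcs s i) (?c i) (?c (Suc i) - 1) \<and> failing k (?c i) (?c (Suc i))" if "i < Suc q" for i
  proof (cases "i = q")
    case True
    then show ?thesis using q good fail by (simp add: s'_def update_apply)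
  next
    case False
    then have "i < q" using that by simp
    then show ?thesis using s(1) by (simp add: pieces_def s'_def update_apply)
  qed
  ultimately have "pieces k (Suc j) ?c (Suc q) s'"
    using s(1) q unfolding pieces_def fa by (simp add: s'_def update_apply)
  moreover have "fault_arcs s' (Suc q) = {}" using s(1) by (simp add: fa pieces_def)
  moreover have "wmem s' ''L'' [] = 0" by (simp add: s'_def update_apply)
  ultimately show ?thesis
    unfolding cut_piece_def
    by (intro wp_Seq_NAssign wp_Seq_WAssign wp_start_piece) (simp add: update_apply q s s'_def)
qed

lemma wp_attempts:
  assumes s: "inputs k s" "nmem s ''g'' [] = card arcs" "pieces k j c q s" "good k (fault_arcs s q) (c q) j"
    and L: "wmem s ''L'' [] = pos (Suc j) - pos (c q)" and y: "nmem s ''y'' [] = p ! Suc j"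
    and ok: "nmem s ''ok'' [] = 0" and j: "nmem s ''j'' [] = j" "Suc j < length p"
  shows "wp (Seq (attempt ''x'') (Seq (attempt ''y'') (Cond (NLess (Num 0) (nvar ''ok'')) extend_piece cut_piece)))
    (attempt_time (nverts G) + (attempt_time (nverts G) + (1 + (1 + (1 + (1 + (1 + (1 + (1 + 1)))))))))
    (invariant k (Suc j)) s"
proof -
  let ?n = "nverts G" and ?L = "pos (Suc j) - pos (c q)"
  let ?post = "\<lambda>z s s'. (if 2 * k * card (ball z ?L) \<le> card arcs then nmem s' ''ok'' [] = 1 \<and> fault_arcs s' q = ball z ?L
     else nmem s' ''ok'' [] = nmem s ''ok'' [] \<and> fault_arcs s' q = fault_arcs s q) \<and>
    (\<forall>i. i \<noteq> q \<longrightarrow> fault_arcs s' i = fault_arcs s i)"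
  let ?X = "{''u'', ''v'', ''r'', ''dist'', ''cnt'', ''ok'', ''out_fault''}"
  have q: "nmem s ''out_q'' [] = q" "nmem s ''x'' [] = p ! c q" "c q \<le> j" "c (Suc q) = Suc j"
    using s(3) by (auto simp: pieces_def)
  have le: "c q \<le> Suc j" "c q < length p" using q j by auto
  have bounded: "S \<subseteq> {..<?n} \<times> {..<?n}" if "S \<subseteq> arcs" for S
    using that arcs_subset by blast
  have fa: "fault_arcs s q \<subseteq> arcs" using s(4) by (simp add: good_def)
  show ?thesis
  proof (rule wp_Seq)
    show "wp (attempt ''x'') (attempt_time ?n) (?post (p ! c q) s) s"
      by (rule wp_attempt[OF s(1) q(2) nth_p_less[OF le(2)] L _ s(2) q(1) bounded[OF fa]]) simp
    fix s1 assume s1: "?post (p ! c q) s s1" and "frame (writes (attempt ''x'')) s s1"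
    then have fr1: "frame ?X s s1" by (simp add: writes_attempt)
    have i1: "inputs k s1" by (rule inputs_frame[OF fr1 _ s(1)]) simp
    have fa1: "fault_arcs s1 q \<subseteq> arcs" using s1 fa ball_subset_arcs by (auto split: if_splits)
    show "wp (Seq (attempt ''y'') (Cond (NLess (Num 0) (nvar ''ok'')) extend_piece cut_piece))
      (attempt_time ?n + (1 + (1 + (1 + (1 + (1 + (1 + (1 + 1)))))))) (invariant k (Suc j)) s1"
    proof (rule wp_Seq)
      show "wp (attempt ''y'') (attempt_time ?n) (?post (p ! Suc j) s1) s1"
        by (rule wp_attempt[OF i1 _ nth_p_less[OF j(2)] _ _ _ _ bounded[OF fa1]])
          (use y L s(2) q(1) in \<open>simp_all add: frameD[OF fr1]\<close>)
      fix s2 assume s2: "?post (p ! Suc j) s1 s2" and "frame (writes (attempt ''y'')) s1 s2"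
      then have fr2: "frame ?X s1 s2" by (simp add: writes_attempt)
      have fr: "frame ?X s s2" by (rule frame_trans[OF fr1 fr2])
      have i2: "inputs k s2" by (rule inputs_frame[OF fr2 _ i1]) simp
      have p2: "pieces k j c q s2"
        by (rule pieces_cong[OF s(3) fr]) (use s1 s2 in auto)
      have vals: "nmem s2 ''y'' [] = p ! Suc j" "nmem s2 ''j'' [] = j" "nmem s2 ''g'' [] = card arcs"
        "wmem s2 ''L'' [] = ?L" "nmem s2 ''path'' [j] = p ! j"
        using y j s(2) L i2 by (simp_all add: frameD[OF fr] inputs_def)
      \<comment> \<open>If both attempts succeed, the ball at \<open>y\<close> overwrites that at
        \<open>x\<close>; if only the first does, its ball survives the second. Either set is good
        by \<open>good_ball\<close>.\<close>
      have cases: "nmem s2 ''ok'' [] = 1 \<and> good k (fault_arcs s2 q) (c q) (Suc j) \<or>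
          nmem s2 ''ok'' [] = 0 \<and> fault_arcs s2 q = fault_arcs s q \<and> failing k (c q) (Suc j)"
        using s1 s2 ok good_ball[OF le(1) j(2)] by (auto simp: failing_def split: if_splits)
      show "wp (Cond (NLess (Num 0) (nvar ''ok'')) extend_piece cut_piece)
        (1 + (1 + (1 + (1 + (1 + (1 + (1 + 1))))))) (invariant k (Suc j)) s2"
      proof (rule wp_Cond)
        assume "bval (NLess (Num 0) (nvar ''ok'')) s2"
        then have good: "good k (fault_arcs s2 q) (c q) (Suc j)" using cases by auto
        show "wp extend_piece (1 + (1 + (1 + (1 + (1 + (1 + 1)))))) (invariant k (Suc j)) s2"
        proof (rule wp_mono[OF wp_extend_piece[OF p2 vals(1)]])
          fix s' assume p': "pieces k (Suc j) (c(Suc q := Suc (Suc j))) q s'"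
            and "frame (writes extend_piece) s2 s'"
          then have fr': "frame {''out_path'', ''out_len''} s2 s'"
            by (elim frame_mono) (auto simp: extend_piece_def)
          have "fault_arcs s' q = fault_arcs s2 q"
            by (simp add: fault_arcs_def frameD[OF fr'])
          moreover have "inputs k s'" by (rule inputs_frame[OF fr' _ i2]) simp
          ultimately show "invariant k (Suc j) s'"
            unfolding invariant_def using good vals(3,4) p'
            by (intro conjI exI[of _ "c(Suc q := Suc (Suc j))"] exI[of _ q]) (simp_all add: frameD[OF fr'])
        qed simp
      next
        assume "\<not> bval (NLess (Num 0) (nvar ''ok'')) s2"
        then have f: "fault_arcs s2 q = fault_arcs s q" "failing k (c q) (Suc j)" using cases by auto
        then have good: "good k (fault_arcs s2 q) (c q) j" using s(4) by simp
        show "wp cut_piece (1 + (1 + (1 + (1 + (1 + (1 + 1)))))) (invariant k (Suc j)) s2"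
        proof (rule wp_mono[OF wp_cut_piece[OF p2 vals(1,2,5) good f(2)] order_refl])
          fix s' assume p': "pieces k (Suc j) (c(Suc (Suc q) := Suc (Suc j))) (Suc q) s' \<and>
              fault_arcs s' (Suc q) = {} \<and> wmem s' ''L'' [] = 0"
            and "frame (writes cut_piece) s2 s'"
          then have fr': "frame {''out_path'', ''out_len'', ''out_edge'', ''out_q'', ''L'', ''x''} s2 s'"
            by (elim frame_mono) (auto simp: cut_piece_def start_piece_def)
          have "inputs k s'" by (rule inputs_frame[OF fr' _ i2]) simp
          then show "invariant k (Suc j) s'"
            unfolding invariant_def using good_empty[OF j(2)] vals(3) p' q(4)
            by (intro conjI exI[of _ "c(Suc (Suc q) := Suc (Suc j))"] exI[of _ "Suc q"]) (simp_all add: frameD[OF fr'])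
        qed
      qed
    qed
  qed
qed

lemma wp_advance:
  assumes "invariant k j s" "nmem s ''j'' [] = j" "Suc j < length p"
  shows "wp advance (advance_time (nverts G)) (invariant k (Suc j)) s"
proof -
  from assms(1) obtain c q where s: "inputs k s" "nmem s ''g'' [] = card arcs" "pieces k j c q s"
    "good k (fault_arcs s q) (c q) j" "wmem s ''L'' [] = pos j - pos (c q)" by (auto simp: invariant_def)
  have pj: "nmem s ''path'' [Suc j] = p ! Suc j" "nmem s ''path'' [j] = p ! j"
    using s(1) assms(3) by (simp_all add: inputs_def)
  have w: "wmem s ''weight'' [p ! j, p ! Suc j] = weight G {p ! j, p ! Suc j}"
    using s(1) p_edge[OF assms(3)] by (simp add: inputs_def)
  define s' where "s' = s\<lparr>wmem := update (wmem s) ''L'' [] (pos (Suc j) - pos (c q)),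
    nmem := update (update (nmem s) ''y'' [] (p ! Suc j)) ''ok'' [] 0\<rparr>"
  have fr: "frame {''y'', ''ok'', ''L''} s s'" by (simp add: frame_def s'_def update_apply)
  have fa: "fault_arcs s' i = fault_arcs s i" for i by (simp add: fault_arcs_def frameD[OF fr])
  have inp: "inputs k s'" by (rule inputs_frame[OF fr _ s(1)]) simp
  have pieces: "pieces k j c q s'" by (rule pieces_cong[OF s(3) fr]) (simp_all add: fa)
  have "wp (Seq (attempt ''x'') (Seq (attempt ''y'') (Cond (NLess (Num 0) (nvar ''ok'')) extend_piece cut_piece)))
    (attempt_time (nverts G) + (attempt_time (nverts G) + (1 + (1 + (1 + (1 + (1 + (1 + (1 + 1)))))))))
    (invariant k (Suc j)) s'"
    by (rule wp_attempts[OF inp _ pieces])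
      (use s(2,4) assms(2,3) in \<open>simp_all add: fa, simp_all add: s'_def update_apply\<close>)
  moreover have "s' = s\<lparr>wmem := update (wmem s) ''L'' [] (wmem s ''L'' [] + weight G {p ! j, p ! Suc j}),
    nmem := update (update (nmem s) ''y'' [] (p ! Suc j)) ''ok'' [] 0\<rparr>"
    by (simp add: s'_def s(5) pos_def algebra_simps)
  ultimately show ?thesis
    unfolding advance_def
    by (intro wp_Seq_NAssign wp_Seq_WAssign) (simp add: update_apply assms(2) pj w)
qed

end

section \<open>Polynomial running time and the final output\<close>

text \<open>Fewer than \<open>n\<close> advances, each with two Bellman-Ford runs of cubic cost,
  give degree 4; the constants are rounded up.\<close>

lemma partition_time:
  fixes n :: nat
  assumes "1 \<le> n" "m \<le> n"
  shows "(1 + for_arcs_time n) + ((1 + (1 + 1)) + (2 + (m - 1) * (advance_time n + 2))) \<le> 200 * n ^ 4"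
proof -
  have pow: "1 \<le> n ^ 2" "n \<le> n ^ 2" "n ^ 2 \<le> n ^ 3" "n ^ 3 \<le> n ^ 4"
    using assms(1) by (simp_all add: power_increasing self_le_power)
  have "for_arcs_time n = 2 + 4 * n + 4 * n ^ 2" by (simp add: algebra_simps power2_eq_square)
  then have arcs: "for_arcs_time n \<le> 10 * n ^ 2" using pow by linarith
  have attempt: "attempt_time n = 12 + 15 * n + 12 * n ^ 2 + 4 * n ^ 3"
    by (simp add: algebra_simps power2_eq_square power3_eq_cube)
  have "advance_time n + 2 = 2 * attempt_time n + 13" by (simp only: mult_2)
  also have "\<dots> \<le> 120 * n ^ 3" unfolding attempt using pow by simp
  finally have "advance_time n + 2 \<le> 120 * n ^ 3" .
  then have "(m - 1) * (advance_time n + 2) \<le> n * (120 * n ^ 3)"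
    using assms(2) by (intro mult_mono) auto
  also have "\<dots> = 120 * n ^ 4" by (simp add: power_eq_if)
  finally show ?thesis using arcs pow by linarith
qed

lemma concat_pieces:
  assumes "\<And>i. i < m \<Longrightarrow> c i \<le> c (Suc i)" "c 0 = 0"
  shows "concat (map (\<lambda>i. map f [c i..<c (Suc i)]) [0..<m]) = map f [0..<c m]"
  using assms(1)
proof (induction m)
  case (Suc m)
  have "[0..<c (Suc m)] = [0..<c m] @ [c m..<c (Suc m)]"
    using upt_add_eq_append[of 0 "c m" "c (Suc m) - c m"] Suc.prems[of m] by simp
  then show ?case using Suc by simp
qed (simp add: assms(2))

context replacement_path
begin

lemma arcs_eq: "{(i, j). i < nverts G \<and> j < nverts G \<and> {i, j} \<in> F} = arcs"
  using fault_verts by (auto simp: arcs_def)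

lemma wp_partition_path:
  "wp partition_path
    ((1 + for_arcs_time (nverts G)) + ((1 + (1 + 1)) + (2 + (length p - 1) * (advance_time (nverts G) + 2))))
    (invariant k (length p - 1)) (input_state G F p k)"
proof -
  let ?n = "nverts G" and ?s = "input_state G F p k"
  have inp: "inputs k ?s" by (auto simp: inputs_def input_state_def)
  show ?thesis
    unfolding partition_path_def
  proof (rule wp_Seq)
    show "wp (count_arcs ''g'' (NLess (Num 0) (NCell ''fault'' [nvar ''u'', nvar ''v''])) (Num 1))
      (1 + for_arcs_time ?n) (\<lambda>s'. nmem s' ''g'' [] = 1 * card {(i, j). i < ?n \<and> j < ?n \<and> {i, j} \<in> F}) ?s"
    proof (rule wp_count_arcs)
      fix i j s' assume *: "frame {''u'', ''v'', ''g''} ?s s'" "nmem s' ''u'' [] = i" "nmem s' ''v'' [] = j"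
      have "inputs k s'" by (rule inputs_frame[OF *(1) _ inp]) simp
      then show "bval (NLess (Num 0) (NCell ''fault'' [nvar ''u'', nvar ''v''])) s' = ({i, j} \<in> F) \<and>
        nval (Num 1) s' = 1"
        using * by (simp add: inputs_def)
    qed (use inp in \<open>auto simp: inputs_def\<close>)
    fix s1
    assume g: "nmem s1 ''g'' [] = 1 * card {(i, j). i < ?n \<and> j < ?n \<and> {i, j} \<in> F}"
      and "frame (writes (count_arcs ''g'' (NLess (Num 0) (NCell ''fault'' [nvar ''u'', nvar ''v''])) (Num 1))) ?s s1"
    then have fr: "frame {''u'', ''v'', ''g''} ?s s1"
      by (elim frame_mono) (auto simp: count_arcs_def)
    have i1: "inputs k s1" by (rule inputs_frame[OF fr _ inp]) simp
    have zero: "nmem s1 ''out_q'' [] = 0" "nmem s1 ''out_fault'' [i, u, v] = 0" "wmem s1 ''L'' [] = 0" for i u v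
      by (simp_all add: frameD[OF fr] input_state_def)
    have p0: "nmem s1 ''path'' [0] = p ! 0" using i1 p_nonempty by (simp add: inputs_def)
    show "wp (Seq (start_piece (NCell ''path'' [Num 0])) (For ''j'' (NSub (nvar ''len'') (Num 1)) advance))
      ((1 + (1 + 1)) + (2 + (length p - 1) * (advance_time ?n + 2))) (invariant k (length p - 1)) s1"
    proof (rule wp_Seq)
      show "wp (start_piece (NCell ''path'' [Num 0])) (1 + (1 + 1)) (invariant k 0) s1"
      proof (rule wp_start_piece)
        let ?s2 = "s1\<lparr>nmem := update (update (update (nmem s1) ''x'' [] (nval (NCell ''path'' [Num 0]) s1))
          ''out_path'' [nmem s1 ''out_q'' [], 0] (nval (NCell ''path'' [Num 0]) s1)) ''out_len'' [nmem s1 ''out_q'' []] 1\<rparr>"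
        have fr2: "frame {''x'', ''out_path'', ''out_len''} s1 ?s2" by (simp add: frame_def update_apply)
        have "inputs k ?s2" by (rule inputs_frame[OF fr2 _ i1]) simp
        moreover have fa: "fault_arcs ?s2 i = {}" for i by (simp add: fault_arcs_def update_apply zero)
        \<comment> \<open>For \<open>q = 0\<close> only \<open>c 0 = 0\<close> and
          \<open>c 1 = 1\<close> matter, so the identity can serve as the cut function.\<close>
        moreover have "pieces k 0 (\<lambda>i. i) 0 ?s2"
          unfolding pieces_def fa by (simp add: update_apply zero p0)
        moreover have "good k {} 0 0" using good_empty[of 0 k] p_nonempty by simp
        ultimately show "invariant k 0 ?s2"
          unfolding invariant_def using g
          by (intro conjI exI[of _ "\<lambda>i. i"] exI[of _ 0]) (simp_all add: update_apply arcs_eq zero)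
      qed
      fix s2 assume s2: "invariant k 0 s2"
      show "wp (For ''j'' (NSub (nvar ''len'') (Num 1)) advance) (2 + (length p - 1) * (advance_time ?n + 2))
        (invariant k (length p - 1)) s2"
      proof (rule wp_For[where I = "invariant k"])
        \<comment> \<open>The invariant does not mention the cell \<open>j\<close>, so it survives
          counter updates.\<close>
        have upd: "invariant k i (s\<lparr>nmem := update (nmem s) ''j'' [] m\<rparr>)" if inv: "invariant k i s" for i s m
        proof -
          let ?s = "s\<lparr>nmem := update (nmem s) ''j'' [] m\<rparr>"
          have fr: "frame {''j''} s ?s" by (simp add: frame_def update_apply)
          have fa: "fault_arcs ?s i = fault_arcs s i" for i by (simp add: fault_arcs_def update_apply)
          from inv obtain c q where "inputs k s" "nmem s ''g'' [] = card arcs" "pieces k i c q s"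
            "good k (fault_arcs s q) (c q) i" "wmem s ''L'' [] = pos i - pos (c q)" by (auto simp: invariant_def)
          moreover have "inputs k ?s" by (rule inputs_frame[OF fr]) (use \<open>inputs k s\<close> in auto)
          moreover have "pieces k i c q ?s"
            by (rule pieces_cong[OF _ fr]) (use \<open>pieces k i c q s\<close> fa in auto)
          ultimately show ?thesis
            unfolding invariant_def
            by (intro conjI exI[of _ c] exI[of _ q]) (simp_all only: frameD[OF fr] fa, simp_all add: update_apply)
        qed
        show "invariant k 0 (s2\<lparr>nmem := update (nmem s2) ''j'' [] 0\<rparr>)" by (rule upd[OF s2])
        show j: "''j'' \<notin> writes advance"
          by (simp add: advance_def writes_attempt extend_piece_def cut_piece_def start_piece_def)
        show "wp advance (advance_time ?n)
          (\<lambda>s''. invariant k (Suc i) (s''\<lparr>nmem := update (nmem s'') ''j'' [] (Suc i)\<rparr>)) s'"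
          if "i < length p - 1" "invariant k i s'" "nmem s' ''j'' [] = i" for i s'
          by (rule wp_mono[OF wp_advance[OF that(2,3)] order_refl upd]) (use that(1) in auto)
        show "nval (NSub (nvar ''len'') (Num 1)) s' = length p - 1"
          if "frame (insert ''j'' (writes advance)) s2 s'" for s'
        proof -
          have "''len'' \<notin> insert ''j'' (writes advance)"
            by (simp add: advance_def writes_attempt extend_piece_def cut_piece_def start_piece_def)
          then show ?thesis using frameD(1)[OF that] s2 by (simp add: invariant_def inputs_def)
        qed
      qed
    qed
  qed
qed

text \<open>The \<open>q\<close> closed pieces are counted through \<open>failing\<close>; the last
  piece, still open, only has to be \<open>good\<close>.\<close>

lemma correct_output_invariant:
  assumes inv: "invariant k (length p - 1) s" and k: "0 < k"
  shows "correct_output 9 G F p k (output_paths s) (output_edges s) (output_faults s)"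
proof -
  from inv obtain c q where p: "pieces k (length p - 1) c q s"
    and g: "good k (fault_arcs s q) (c q) (length p - 1)" by (auto simp: invariant_def)
  have q: "nmem s ''out_q'' [] = q" "c 0 = 0" "c (Suc q) = length p"
    using p p_nonempty by (auto simp: pieces_def)
  have piece: "c i < c (Suc i)" "nmem s ''out_len'' [i] = c (Suc i) - c i"
    "\<And>m. c i + m < c (Suc i) \<Longrightarrow> nmem s ''out_path'' [i, m] = p ! (c i + m)" if "i \<le> q" for i
    using p that by (auto simp: pieces_def)
  have goods: "good k (fault_arcs s i) (c i) (c (Suc i) - 1)" if "i \<le> q" for i
    using p g q(3) that by (cases "i = q") (auto simp: pieces_def)
  have paths: "output_paths s = map (\<lambda>i. map ((!) p) [c i..<c (Suc i)]) [0..<Suc q]"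
    unfolding output_paths_def q(1)
  proof (rule map_cong[OF refl])
    fix i assume "i \<in> set [0..<Suc q]"
    then have "i \<le> q" by auto
    from piece[OF this] show "map (\<lambda>j. nmem s ''out_path'' [i, j]) [0..<nmem s ''out_len'' [i]] =
        map ((!) p) [c i..<c (Suc i)]"
      by (intro nth_equalityI) auto
  qed
  have edges: "output_edges s = map (\<lambda>i. {p ! (c (Suc i) - 1), p ! c (Suc i)}) [0..<q]"
    unfolding output_edges_def q(1) using p by (intro map_cong) (auto simp: pieces_def)
  have faults: "output_faults s = map (\<lambda>i. edge_set (fault_arcs s i)) [0..<Suc q]"
    unfolding output_faults_def q(1) by (intro map_cong) (auto simp: fault_arcs_def)
  have nth_paths: "output_paths s ! i = map ((!) p) [c i..<c (Suc i)]" if "i \<le> q" for i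
    using that unfolding paths by (simp del: upt_Suc)
  have lens: "length (output_paths s) = Suc q" "length (output_edges s) = q" "length (output_faults s) = Suc q"
    by (simp_all add: paths edges faults)
  have "decomposition p (output_paths s) (output_edges s)"
    unfolding decomposition_def lens
  proof (intro conjI allI impI ballI refl)
    fix r assume "r \<in> set (output_paths s)"
    then obtain i where "i \<le> q" "r = map ((!) p) [c i..<c (Suc i)]"
      unfolding paths by (auto simp: less_Suc_eq_le simp del: upt_Suc)
    then show "r \<noteq> []" using piece(1)[of i] by simp
  next
    have "concat (output_paths s) = map ((!) p) [0..<c (Suc q)]"
      unfolding paths by (rule concat_pieces) (use piece(1) q(2) in \<open>auto simp: less_Suc_eq_le intro: less_imp_le\<close>)
    then show "p = concat (output_paths s)" by (simp only: q(3) map_nth)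
  next
    fix i assume i: "i < q"
    have "last (output_paths s ! i) = p ! (c (Suc i) - 1)"
      using i piece(1)[of i] by (simp add: nth_paths last_map)
    moreover have "hd (output_paths s ! Suc i) = p ! c (Suc i)"
      using i piece(1)[of "Suc i"] by (simp add: nth_paths hd_map)
    ultimately show "output_edges s ! i = {last (output_paths s ! i), hd (output_paths s ! Suc i)}"
      using i by (simp add: edges)
  qed
  moreover have "q \<le> 8 * k + 1"
  proof (rule number_of_pieces)
    show "c i < c (Suc i)" if "i < q" for i using piece(1) that by simp
    show "c q < length p" using piece(1)[of q] q(3) by simp
  qed (use p in \<open>auto simp: pieces_def failing_def\<close>)
  \<comment> \<open>The additive 1 is absorbed by \<open>k\<close>, which gives the constant
    9.\<close>
  then have "real q \<le> 9 * real k" using k by linarith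
  moreover have "output_faults s ! i \<subseteq> F \<and> real (card (output_faults s ! i)) \<le> real (card F) / real k \<and>
      shortest_path (del_edges G (output_faults s ! i)) (output_paths s ! i)" if i: "i < Suc q" for i
  proof -
    have S: "output_faults s ! i = edge_set (fault_arcs s i)" using i by (simp add: faults del: upt_Suc)
    have gi: "fault_arcs s i \<subseteq> arcs" "2 * k * card (fault_arcs s i) \<le> card arcs"
      "shortest_path (del_edges G (edge_set (fault_arcs s i))) (map ((!) p) [c i..<Suc (c (Suc i) - 1)])"
      using goods[of i] i by (simp_all add: good_def)
    \<comment> \<open>Both directions of a fault yield the same edge, so passing to edges can only
      shrink the set.\<close>
    have "card (edge_set (fault_arcs s i)) \<le> card (fault_arcs s i)"
      by (rule card_image_le) (rule finite_subset[OF gi(1) finite_arcs])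
    then have "2 * k * card (edge_set (fault_arcs s i)) \<le> 2 * k * card (fault_arcs s i)" by simp
    also have "\<dots> \<le> 2 * card F" using gi(2) card_arcs_le by simp
    finally have "card (edge_set (fault_arcs s i)) * k \<le> card F" by (simp add: mult.commute)
    then have "real (card (edge_set (fault_arcs s i))) * real k \<le> real (card F)"
      by (simp only: of_nat_mult[symmetric] of_nat_le_iff)
    then have "real (card (edge_set (fault_arcs s i))) \<le> real (card F) / real k"
      using k by (simp add: pos_le_divide_eq)
    moreover have "edge_set (fault_arcs s i) \<subseteq> F" using gi(1) by (auto simp: arcs_def)
    moreover have "Suc (c (Suc i) - 1) = c (Suc i)" using piece(1)[of i] i by simp
    ultimately show ?thesis using gi(3) i by (simp add: S nth_paths)
  qed
  ultimately show ?thesis unfolding correct_output_def lens by blast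
qed

end

theorem theorem1p8:
  "\<exists>(A :: prog) (C :: real) (c :: nat) (d :: nat).
     \<forall>(G :: wgraph) (F :: nat set set) (p :: nat list) (k :: nat).
       weighted_graph G \<and> F \<subseteq> edges G \<and> shortest_path (del_edges G F) p \<and> 0 < k \<longrightarrow>
       (\<exists>t s. exec A (input_state G F p k) t s \<and>
              t \<le> c * (nverts G + card F) ^ d \<and>
              correct_output C G F p k (output_paths s) (output_edges s) (output_faults s))"
\<comment> \<open>The constant 9 comes from \<open>correct_output_invariant\<close>, 200 and the
  exponent 4 from \<open>partition_time\<close>.\<close>
proof (rule exI[of _ partition_path], rule exI[of _ 9], rule exI[of _ 200], rule exI[of _ 4], intro allI impI)
  fix G :: wgraph and F :: "nat set set" and p :: "nat list" and k :: nat
  assume *: "weighted_graph G \<and> F \<subseteq> edges G \<and> shortest_path (del_edges G F) p \<and> 0 < k"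
  interpret replacement_path G F p using * by unfold_locales auto
  have n: "1 \<le> nverts G" "length p \<le> nverts G"
    using length_p_le p_nonempty by (simp_all add: Suc_le_eq) (cases p, auto)
  obtain t s where ts: "exec partition_path (input_state G F p k) t s"
    "t \<le> (1 + for_arcs_time (nverts G)) + ((1 + (1 + 1)) + (2 + (length p - 1) * (advance_time (nverts G) + 2)))"
    "invariant k (length p - 1) s"
    using wp_partition_path[of k] unfolding wp_def by blast
  have "t \<le> 200 * nverts G ^ 4" using ts(2) partition_time[OF n] by (rule order_trans)
  also have "\<dots> \<le> 200 * (nverts G + card F) ^ 4" by (intro mult_left_mono power_mono) auto
  finally show "\<exists>t s. exec partition_path (input_state G F p k) t s \<and> t \<le> 200 * (nverts G + card F) ^ 4 \<and>
      correct_output 9 G F p k (output_paths s) (output_edges s) (output_faults s)"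
    using ts(1) correct_output_invariant[OF ts(3)] * by blast
qed

end
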